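(* Let $0<\Theta<1$, $0<p_0,p_1\le\infty$, $0<q_0,q_1\le\infty$ and $s_0,s_1\in\mathbb{R}$. Put $$\frac1p:=\frac{1-\Theta}{p_0}+\frac{\Theta}{p_1},\qquad \frac1q:=\frac{1-\Theta}{q_0}+\frac{\Theta}{q_1},\qquad s:=(1-\Theta)s_0+\Theta s_1 .$$ Let $w_0,w_1\in\mathcal{A}_\infty^{\ell oc}$ be weights on $\mathbb{R}^d$ and define $w:=w_0^{\frac{(1-\Theta)p}{p_0}}\,w_1^{\frac{\Theta p}{p_1}}$. Then the Calderón product satisfies $$b^{s_0}_{p_0,q_0}(\mathbb{R}^d,w_0)^{1-\Theta}\,b^{s_1}_{p_1,q_1}(\mathbb{R}^d,w_1)^{\Theta}=b^{s}_{p,q}(\mathbb{R}^d,w)$$ in the sense of equivalent quasi-norms (the two sets coincide and their quasi-norms are equivalent).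
   Context: Weights: a weight is a nonnegative locally integrable function $w$ on $\mathbb{R}^d$. For $1<r<\infty$, $1/r+1/r'=1$, $w\in\mathcal{A}_r^{\ell oc}$ (local Muckenhoupt class) if $\sup_{|B|\le 1}\big(\frac1{|B|}\int_B w\,dx\big)^{1/r}\big(\frac1{|B|}\int_B w^{-r'/r}\,dx\big)^{1/r'}<\infty$, the supremum being over all balls $B\subset\mathbb{R}^d$ of volume $\le 1$ (so $w>0$ a.e.). $\mathcal{A}_\infty^{\ell oc}:=\bigcup_{r>1}\mathcal{A}_r^{\ell oc}$. $\|f|L_p(\mathbb{R}^d,w)\|:=\big(\int|f|^p\,w\,dx\big)^{1/p}$ for $p<\infty$; convention: $L_\infty(\mathbb{R}^d,w):=L_\infty(\mathbb{R}^d)$ (the weight is always taken $\equiv1$ when $p=\infty$). In the formula for $w$: if $p_1=\infty>p_0$ then $w=w_0$, if $p_0=\infty>p_1$ then $w=w_1$; if $p_0=p_1=\infty$ then $w:=1$ (no weight plays a role). Sequence spaces: for $j\in\mathbb{N}_0$, $k\in\mathbb{Z}^d$, $Q_{j,k}:=\{x: 2^{-j}k_\ell\le x_\ell<2^{-j}(k_\ell+1),\ \ell=1,\dots,d\}$ and $\mathcal{X}_{j,k}$ is its characteristic function. For $0<p,q\le\infty$, $s\in\mathbb{R}$, $b^s_{p,q}(\mathbb{R}^d,w)$ is the set of complex sequences $\lambda=(\lambda_{j,k})_{j\in\mathbb{N}_0,k\in\mathbb{Z}^d}$ with $$\|\lambda|b^s_{p,q}(\mathbb{R}^d,w)\|:=\Big(\sum_{j=0}^\infty\Big\|\sum_{k\in\mathbb{Z}^d}2^{sj}|\lambda_{j,k}|\mathcal{X}_{j,k}(\cdot)\Big|L_p(\mathbb{R}^d,w)\Big\|^q\Big)^{1/q}<\infty$$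 (supremum over $j$ if $q=\infty$). Calderón product: for quasi-Banach lattices $X_0,X_1$ of functions on a $\sigma$-finite measure space (here $\mathbb{N}_0\times\mathbb{Z}^d$ with counting measure), $X_0^{1-\Theta}X_1^\Theta$ is the set of measurable functions $f$ for which $\|f|X_0^{1-\Theta}X_1^\Theta\|:=\inf\{\|f_0|X_0\|^{1-\Theta}\|f_1|X_1\|^{\Theta}: |f|\le|f_0|^{1-\Theta}|f_1|^\Theta\text{ a.e.},\ f_j\in X_j,\ j=0,1\}$ is finite. *)

theory Defs
  imports "HOL-Analysis.Analysis" "HOL-Probability.Essential_Supremum"
begin

text \<open>Real powers on \<open>[0,\<infinity>]\<close>; only used with an exponent \<open>a > 0\<close>.\<close>

definition ennpowr :: "ennreal \<Rightarrow> real \<Rightarrow> ennreal" where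
  "ennpowr x a = (if x = \<infinity> then \<infinity> else ennreal (enn2real x powr a))"


definition weight :: "(real ^ 'd \<Rightarrow> real) \<Rightarrow> bool" where
  "weight w \<longleftrightarrow> w \<in> borel_measurable lebesgue \<and> (\<forall>x. 0 \<le> w x) \<and>
     (\<forall>K. compact K \<longrightarrow> set_integrable lebesgue K w)"

definition average :: "(real ^ 'd) set \<Rightarrow> (real ^ 'd \<Rightarrow> real) \<Rightarrow> ennreal" where
  "average B f = (\<integral>\<^sup>+ x\<in>B. ennreal (f x) \<partial>lebesgue) / emeasure lebesgue B"

text \<open>
  Positivity almost everywhere has to be required explicitly: with the conventions
  \<open>0 powr a = 0\<close> on the reals and \<open>0 * \<infinity> = 0\<close> on \<open>[0,\<infinity>]\<close>, finiteness of the supremum would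
  not exclude weights that vanish on a set of positive measure.
\<close>

definition A_loc :: "real \<Rightarrow> (real ^ 'd \<Rightarrow> real) set" where
  "A_loc r = {w. weight w \<and> (AE x in lebesgue. 0 < w x) \<and>
     (let r' = r / (r - 1) in
       (SUP B \<in> {ball x \<rho> | x \<rho>. 0 < \<rho> \<and> emeasure lebesgue (ball x \<rho>) \<le> 1}.
          ennpowr (average B w) (1 / r) *
          ennpowr (average B (\<lambda>x. w x powr (- r' / r))) (1 / r')) < \<infinity>)}"

definition A_loc_infinity :: "(real ^ 'd \<Rightarrow> real) set" where
  "A_loc_infinity = (\<Union>r \<in> {1<..}. A_loc r)"


text \<open>The weight plays no role for \<open>p = \<infinity>\<close>.\<close>

definition Lp_qnorm :: "ennreal \<Rightarrow> (real ^ 'd \<Rightarrow> real) \<Rightarrow> (real ^ 'd \<Rightarrow> real) \<Rightarrow> ennreal" where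
  "Lp_qnorm p w f =
     (if p = \<infinity> then esssup lebesgue (\<lambda>x. ennreal \<bar>f x\<bar>)
      else ennpowr (\<integral>\<^sup>+ x. ennreal (\<bar>f x\<bar> powr enn2real p * w x) \<partial>lebesgue) (1 / enn2real p))"

definition lq_qnorm :: "ennreal \<Rightarrow> (nat \<Rightarrow> ennreal) \<Rightarrow> ennreal" where
  "lq_qnorm q a =
     (if q = \<infinity> then (SUP j. a j)
      else ennpowr (\<Sum>j. ennpowr (a j) (enn2real q)) (1 / enn2real q))"

definition interpolated_weight ::
    "real \<Rightarrow> ennreal \<Rightarrow> ennreal \<Rightarrow> ennreal \<Rightarrow> (real ^ 'd \<Rightarrow> real) \<Rightarrow> (real ^ 'd \<Rightarrow> real) \<Rightarrow> real ^ 'd \<Rightarrow> real" where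
  "interpolated_weight \<Theta> p p0 p1 w0 w1 =
     (if p0 = \<infinity> \<and> p1 = \<infinity> then (\<lambda>x. 1)
      else if p1 = \<infinity> then w0
      else if p0 = \<infinity> then w1
      else (\<lambda>x. w0 x powr ((1 - \<Theta>) * enn2real p / enn2real p0) *
                w1 x powr (\<Theta> * enn2real p / enn2real p1)))"


text \<open>
  A quasi-normed function space is represented by its carrier together with a
  \<open>[0,\<infinity>]\<close>-valued quasi-norm.
\<close>

type_synonym 'a qspace = "('a \<Rightarrow> complex) set \<times> (('a \<Rightarrow> complex) \<Rightarrow> ennreal)"

definition calderon_product :: "'a measure \<Rightarrow> real \<Rightarrow> 'a qspace \<Rightarrow> 'a qspace \<Rightarrow> 'a qspace" where
  "calderon_product M \<Theta> X0 X1 =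
     (let N = (\<lambda>f. INF (f0, f1) \<in> {(f0, f1). f0 \<in> fst X0 \<and> f1 \<in> fst X1 \<and>
                     (AE x in M. cmod (f x) \<le> cmod (f0 x) powr (1 - \<Theta>) * cmod (f1 x) powr \<Theta>)}.
                   ennpowr (snd X0 f0) (1 - \<Theta>) * ennpowr (snd X1 f1) \<Theta>)
      in ({f \<in> borel_measurable M. N f < \<infinity>}, N))"

definition equal_equivalent_qnorms :: "'a qspace \<Rightarrow> 'a qspace \<Rightarrow> bool" where
  "equal_equivalent_qnorms X Y \<longleftrightarrow> fst X = fst Y \<and>
     (\<exists>c C :: real. 0 < c \<and> 0 < C \<and>
       (\<forall>f \<in> fst X. ennreal c * snd X f \<le> snd Y f \<and> snd Y f \<le> ennreal C * snd X f))"


definition dyadic_cube :: "nat \<Rightarrow> int ^ 'd \<Rightarrow> (real ^ 'd) set" where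
  "dyadic_cube j k = {x. \<forall>l. 2 powr (- real j) * of_int (k $ l) \<le> x $ l \<and>
                            x $ l < 2 powr (- real j) * (of_int (k $ l) + 1)}"

text \<open>For fixed \<open>j\<close> the cubes are disjoint, so the inner sum has at most one nonzero term.\<close>

definition b_qnorm ::
    "real \<Rightarrow> ennreal \<Rightarrow> ennreal \<Rightarrow> (real ^ 'd \<Rightarrow> real) \<Rightarrow> (nat \<times> (int ^ 'd) \<Rightarrow> complex) \<Rightarrow> ennreal" where
  "b_qnorm s p q w u = lq_qnorm q (\<lambda>j. Lp_qnorm p w (\<lambda>x.
     \<Sum>\<^sub>\<infinity>k. 2 powr (s * real j) * cmod (u (j, k)) * indicator (dyadic_cube j k) x))"

definition b_space ::
    "real \<Rightarrow> ennreal \<Rightarrow> ennreal \<Rightarrow> (real ^ 'd \<Rightarrow> real) \<Rightarrow> (nat \<times> (int ^ 'd)) qspace" where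
  "b_space s p q w = ({u. b_qnorm s p q w u < \<infinity>}, b_qnorm s p q w)"

end

theory Submission
  imports Defs
begin

text \<open>
  On level \<open>j\<close> the norm of \<open>L\<^sub>p(w)\<close> is a weighted \<open>\<ell>\<^sub>p\<close> norm with weights \<open>w(Q\<^sub>j\<^sub>k)\<close>, so
  \<open>b\<^sub>p\<^sub>q\<close> is a weighted \<open>\<ell>\<^sub>q(\<ell>\<^sub>p)\<close> space with entries weighted by
  \<open>v(j,k) = 2\<^sup>s\<^sup>j w(Q\<^sub>j\<^sub>k)\<^sup>1\<^sup>/\<^sup>p\<close>. For such spaces the Calderon product is the space with the weight
  \<open>v\<^sub>0 powr (1 - \<Theta>) * v\<^sub>1 powr \<Theta>\<close>: one inclusion is Hoelder's inequality, and an explicit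
  factorization gives the other. It remains to see that \<open>w(Q)\<close> is comparable to
  \<open>w\<^sub>0(Q) powr \<alpha> * w\<^sub>1(Q) powr \<beta>\<close> with \<open>\<alpha> = (1 - \<Theta>) p / p\<^sub>0\<close>, \<open>\<beta> = \<Theta> p / p\<^sub>1\<close>, uniformly in the dyadic
  cubes of side at most 1. The upper bound is Hoelder's inequality. For the lower bound, on a ball of
  volume at most 1 apply Hoelder's inequality to \<open>1 = w\<^sup>t w\<^sub>0 powr (- \<alpha> t) * w\<^sub>1 powr (- \<beta> t)\<close> with
  \<open>1 / t = \<alpha> r\<^sub>0 + \<beta> r\<^sub>1\<close>, where \<open>w\<^sub>i \<in> A_loc r\<^sub>i\<close>, and use the Muckenhoupt conditions. A cube need
  not lie in a ball of volume at most 1, so it is compared, by a chain of doubling steps, with a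
  small concentric ball inside it.
\<close>

section \<open>Powers and sequence quasi-norms\<close>

lemma ennpowr_ennreal: "0 \<le> x \<Longrightarrow> ennpowr (ennreal x) a = ennreal (x powr a)"
  by (simp add: ennpowr_def)

lemma ennpowr_infinity [simp]: "ennpowr \<infinity> a = \<infinity>" "ennpowr top a = top"
  by (auto simp: ennpowr_def)

lemma ennpowr_zero [simp]: "ennpowr 0 a = 0"
  by (simp add: ennpowr_def)

lemma ennpowr_one [simp]: "ennpowr x 1 = x"
  by (cases x) (auto simp: ennpowr_def)

lemma ennpowr_eq_0_iff [simp]: "ennpowr x a = 0 \<longleftrightarrow> x = 0"
  by (cases x) (auto simp: ennpowr_def)

lemma ennpowr_eq_top_iff [simp]: "ennpowr x a = top \<longleftrightarrow> x = top"
  by (cases x) (auto simp: ennpowr_def)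

lemma ennpowr_mono: "0 \<le> a \<Longrightarrow> x \<le> y \<Longrightarrow> ennpowr x a \<le> ennpowr y a"
  by (cases x; cases y) (auto simp: ennpowr_def top_unique intro!: ennreal_leI powr_mono2)

text \<open>The exponent is arbitrary: \<open>ennpowr\<close> fixes 0 and \<infinity> for every
  \<open>a\<close>, in agreement with \<open>0 * top = 0\<close>.\<close>

lemma ennpowr_mult: "ennpowr (x * y) a = ennpowr x a * ennpowr y a"
  by (cases x; cases y)
    (auto simp: ennpowr_ennreal ennreal_mult[symmetric] powr_mult ennreal_mult_eq_top_iff
      ennreal_mult_top ennreal_top_mult top_unique)

lemma ennpowr_ennpowr: "ennpowr (ennpowr x a) b = ennpowr x (a * b)"
  by (cases x) (auto simp: ennpowr_ennreal powr_powr)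

section \<open>Hoelder's inequality for integrals\<close>

lemma borel_measurable_ennpowr [measurable (raw)]:
  assumes [measurable]: "f \<in> borel_measurable M"
  shows "(\<lambda>x. ennpowr (f x) a) \<in> borel_measurable M"
  unfolding ennpowr_def by measurable

text \<open>After division by the two integrals this is the weighted Young inequality, integrated.
  Integrals equal to 0 or \<infinity> cannot be divided by and are treated separately.\<close>

lemma nn_integral_Holder:
  fixes f g :: "'a \<Rightarrow> ennreal"
  assumes [measurable]: "f \<in> borel_measurable M" "g \<in> borel_measurable M"
    and ab: "0 < a" "0 < b" "a + b = 1"
  shows "(\<integral>\<^sup>+x. ennpowr (f x) a * ennpowr (g x) b \<partial>M)
    \<le> ennpowr (\<integral>\<^sup>+x. f x \<partial>M) a * ennpowr (\<integral>\<^sup>+x. g x \<partial>M) b"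
proof -
  define F G where "F = (\<integral>\<^sup>+x. f x \<partial>M)" and "G = (\<integral>\<^sup>+x. g x \<partial>M)"
  consider "F = 0 \<or> G = 0" | "F \<noteq> 0" "G \<noteq> 0" "F = top \<or> G = top"
    | "F \<noteq> 0" "G \<noteq> 0" "F \<noteq> top" "G \<noteq> top"
    by blast
  then show ?thesis
  proof cases
    case 1
    then have "(AE x in M. f x = 0) \<or> (AE x in M. g x = 0)"
      by (simp add: F_def G_def nn_integral_0_iff_AE)
    then have "AE x in M. ennpowr (f x) a * ennpowr (g x) b = 0"
      by (elim disjE) (auto elim!: eventually_mono)
    then have "(\<integral>\<^sup>+x. ennpowr (f x) a * ennpowr (g x) b \<partial>M) = 0"
      by (subst nn_integral_0_iff_AE) auto
    then show ?thesis
      by simp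
  next
    case 2
    then have "ennpowr F a * ennpowr G b = top"
      by (auto simp: ennreal_mult_eq_top_iff)
    then show ?thesis
      by (simp add: F_def G_def)
  next
    case 3
    then obtain x y where xy: "F = ennreal x" "G = ennreal y" "0 < x" "0 < y"
      by (cases F; cases G) (auto simp: less_le)
    \<comment> \<open>\<open>K\<close> undoes the normalization: \<open>le\<close> is Young's
      inequality for \<open>u / x\<close> and \<open>v / y\<close>, multiplied by
      \<open>K\<close>.\<close>
    define K where "K = x powr a * y powr b"
    have K: "0 < K"
      using xy by (simp add: K_def)
    have le: "ennpowr u a * ennpowr v b \<le> ennreal K * (ennreal (a / x) * u + ennreal (b / y) * v)" for u v
    proof (cases "u = top \<or> v = top \<or> u = 0 \<or> v = 0")
      case True
      then show ?thesis
        using K ab xy by (auto simp: ennreal_mult_top ennreal_mult_eq_top_iff)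
    next
      case False
      then obtain r t where rt: "u = ennreal r" "v = ennreal t" "0 < r" "0 < t"
        by (cases u; cases v) (auto simp: less_le)
      have "(r / x) powr a * (t / y) powr b \<le> a * (r / x) + b * (t / y)"
        using rt xy ab by (intro Youngs_inequality_0) auto
      then have "r powr a * t powr b \<le> K * (a / x * r + b / y * t)"
        using xy rt by (simp add: powr_divide K_def divide_simps mult.commute split: if_splits)
      then show ?thesis
        using rt K xy ab
        by (simp add: ennpowr_ennreal ennreal_mult[symmetric] ennreal_plus[symmetric] del: ennreal_plus)
    qed
    have "(\<integral>\<^sup>+x. ennpowr (f x) a * ennpowr (g x) b \<partial>M)
      \<le> (\<integral>\<^sup>+z. ennreal K * (ennreal (a / x) * f z + ennreal (b / y) * g z) \<partial>M)"
      by (intro nn_integral_mono le)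
    also have "\<dots> = ennreal K * (ennreal (a / x) * F + ennreal (b / y) * G)"
      by (simp add: nn_integral_cmult nn_integral_add F_def G_def)
    also have "\<dots> = ennreal K"
      using xy ab K by (simp add: ennreal_mult[symmetric] ennreal_plus[symmetric] del: ennreal_plus)
    also have "\<dots> = ennpowr F a * ennpowr G b"
      using xy by (simp add: K_def ennpowr_ennreal ennreal_mult)
    finally show ?thesis
      by (simp add: F_def G_def)
  qed
qed

section \<open>Quasi-norms of sequences\<close>

definition seq_qnorm :: "ennreal \<Rightarrow> ('i \<Rightarrow> ennreal) \<Rightarrow> ennreal" where
  "seq_qnorm p a =
     (if p = \<infinity> then (SUP i. a i)
      else ennpowr (\<integral>\<^sup>+i. ennpowr (a i) (enn2real p) \<partial>count_space UNIV) (1 / enn2real p))"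

text \<open>\<open>seq_qnorm\<close> has an arbitrary index type so that the sum over cubes and the
  sum over levels share one theory; this identifies the latter.\<close>

lemma lq_qnorm_eq_seq_qnorm: "lq_qnorm q a = seq_qnorm q a"
  by (simp add: lq_qnorm_def seq_qnorm_def nn_integral_count_space_nat)

lemma seq_qnorm_mono: "(\<And>i. a i \<le> b i) \<Longrightarrow> seq_qnorm p a \<le> seq_qnorm p b"
  unfolding seq_qnorm_def
  by (auto intro!: SUP_mono ennpowr_mono nn_integral_mono)

lemma enn2real_pos: "0 < p \<Longrightarrow> p \<noteq> top \<Longrightarrow> 0 < enn2real p"
  by (simp add: enn2real_positive_iff less_top)

lemma seq_qnorm_cmult:
  assumes "0 < p"
  shows "seq_qnorm p (\<lambda>i. c * a i) = c * seq_qnorm p a"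
  using enn2real_pos[OF assms]
  by (auto simp: seq_qnorm_def SUP_mult_left_ennreal ennpowr_mult nn_integral_cmult ennpowr_ennpowr)

lemma le_seq_qnorm:
  assumes "0 < p"
  shows "a i \<le> seq_qnorm p a"
proof (cases "p = top")
  case True
  then show ?thesis
    by (auto simp: seq_qnorm_def intro: SUP_upper)
next
  case False
  note p = enn2real_pos[OF assms False]
  have "ennpowr (a i) (enn2real p) \<le> (\<integral>\<^sup>+i. ennpowr (a i) (enn2real p) \<partial>count_space UNIV)"
    by (rule nn_integral_ge_point) auto
  from ennpowr_mono[OF _ this, of "1 / enn2real p"] p show ?thesis
    using False by (simp add: seq_qnorm_def ennpowr_ennpowr)
qed

lemma seq_qnorm_le_iff_top: "seq_qnorm top a \<le> c \<longleftrightarrow> (\<forall>i. a i \<le> c)"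
  by (auto simp: seq_qnorm_def SUP_le_iff)

text \<open>Since \<open>enn2real \<infinity> = 0\<close> and \<open>1 / 0 = 0\<close>, the relation between the exponents takes the
  same form when some of them are infinite.\<close>

lemma exponent_relation:
  fixes p p0 p1 :: ennreal and \<Theta> :: real
  assumes \<Theta>: "0 < \<Theta>" "\<Theta> < 1" and p01: "0 < p0" "0 < p1"
    and eq: "1 / p = ennreal (1 - \<Theta>) / p0 + ennreal \<Theta> / p1"
  shows "0 < p" and "p = top \<longleftrightarrow> p0 = top \<and> p1 = top"
    and "1 / enn2real p = (1 - \<Theta>) / enn2real p0 + \<Theta> / enn2real p1"
proof -
  have top: "ennreal c / top = 0" for c
    by (simp add: divide_ennreal_def)
  have div: "ennreal c / ennreal x = ennreal (c / x)" if "0 \<le> c" "0 < x" for c x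
    using that by (simp add: divide_ennreal)
  have "p \<noteq> 0"
  proof -
    have "ennreal (1 - \<Theta>) / p0 < top" "ennreal \<Theta> / p1 < top"
      using p01 by (auto simp: less_top[symmetric] ennreal_divide_eq_top_iff)
    then have "1 / p < top"
      unfolding eq by simp
    then show ?thesis
      by auto
  qed
  then show "0 < p"
    by (simp add: zero_less_iff_neq_zero)
  show "p = top \<longleftrightarrow> p0 = top \<and> p1 = top"
  proof
    assume "p = top"
    then have "ennreal (1 - \<Theta>) / p0 = 0 \<and> ennreal \<Theta> / p1 = 0"
      using eq by (simp add: top[of 1, simplified])
    then show "p0 = top \<and> p1 = top"
      using \<Theta> by (auto simp: ennreal_divide_eq_0_iff)
  next
    assume "p0 = top \<and> p1 = top"
    then show "p = top"
      using eq by (simp add: top ennreal_divide_eq_0_iff)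
  qed
  have quotient: "ennreal c / x = ennreal (c / enn2real x)" if "0 \<le> c" "0 < x" for c x
  proof (cases "x = top")
    case True
    then show ?thesis by (simp add: top)
  next
    case False
    then show ?thesis using div[OF that(1), of "enn2real x"] enn2real_pos[OF that(2)]
      by (simp add: less_top)
  qed
  have "ennreal (1 / enn2real p) = ennreal ((1 - \<Theta>) / enn2real p0 + \<Theta> / enn2real p1)"
    using eq quotient[of 1 p] quotient[of "1 - \<Theta>" p0] quotient[of \<Theta> p1] \<Theta> p01 \<open>0 < p\<close>
    by (simp add: ennreal_plus[symmetric] del: ennreal_plus)
  then show "1 / enn2real p = (1 - \<Theta>) / enn2real p0 + \<Theta> / enn2real p1"
    using \<Theta> by (subst (asm) ennreal_inj) (auto intro!: add_nonneg_nonneg divide_nonneg_nonneg)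
qed

text \<open>For finite exponents this is Hoelder's inequality for the counting measure. If exactly
  one of \<open>p0\<close>, \<open>p1\<close> is infinite, the factor with the supremum is pulled
  out, and what remains is an identity between powers.\<close>

lemma seq_qnorm_Holder:
  fixes p p0 p1 :: ennreal and \<Theta> :: real
  assumes \<Theta>: "0 < \<Theta>" "\<Theta> < 1" and p01: "0 < p0" "0 < p1"
    and eq: "1 / p = ennreal (1 - \<Theta>) / p0 + ennreal \<Theta> / p1"
  shows "seq_qnorm p (\<lambda>i. ennpowr (a i) (1 - \<Theta>) * ennpowr (b i) \<Theta>)
    \<le> ennpowr (seq_qnorm p0 a) (1 - \<Theta>) * ennpowr (seq_qnorm p1 b) \<Theta>"
proof (cases "p = top")
  case True
  then have "p0 = top" "p1 = top"
    using exponent_relation[OF assms] by auto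
  then show ?thesis
    unfolding True seq_qnorm_le_iff_top using \<Theta>
    by (auto intro!: mult_mono ennpowr_mono le_seq_qnorm)
next
  case False
  note rel = exponent_relation[OF assms]
  define r r0 r1 where "r = enn2real p" and "r0 = enn2real p0" and "r1 = enn2real p1"
  have r: "0 < r"
    using rel False enn2real_pos by (auto simp: r_def)
  have rel': "1 / r = (1 - \<Theta>) / r0 + \<Theta> / r1"
    using rel by (simp add: r_def r0_def r1_def)
  consider (fin) "p0 \<noteq> top" "p1 \<noteq> top" | (inf0) "p0 = top" "p1 \<noteq> top" | (inf1) "p0 \<noteq> top" "p1 = top"
    using False rel(2) by blast
  then show ?thesis
  proof cases
    case fin
    have r01: "0 < r0" "0 < r1"
      using fin p01 enn2real_pos by (auto simp: r0_def r1_def)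
    \<comment> \<open>Conjugate weights: the exponent relation multiplied by \<open>r\<close> says
      that their sum is 1.\<close>
    define \<alpha> \<beta> where "\<alpha> = (1 - \<Theta>) * r / r0" and "\<beta> = \<Theta> * r / r1"
    have ab: "0 < \<alpha>" "0 < \<beta>" "\<alpha> + \<beta> = 1"
      using \<Theta> r r01 rel' by (auto simp: \<alpha>_def \<beta>_def field_simps)
    have "(\<integral>\<^sup>+i. ennpowr (ennpowr (a i) (1 - \<Theta>) * ennpowr (b i) \<Theta>) r \<partial>count_space UNIV)
      = (\<integral>\<^sup>+i. ennpowr (ennpowr (a i) r0) \<alpha> * ennpowr (ennpowr (b i) r1) \<beta> \<partial>count_space UNIV)"
      using r01 by (simp add: ennpowr_mult ennpowr_ennpowr \<alpha>_def \<beta>_def)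
    also have "\<dots> \<le> ennpowr (\<integral>\<^sup>+i. ennpowr (a i) r0 \<partial>count_space UNIV) \<alpha>
        * ennpowr (\<integral>\<^sup>+i. ennpowr (b i) r1 \<partial>count_space UNIV) \<beta>"
      by (intro nn_integral_Holder ab) auto
    finally have "seq_qnorm p (\<lambda>i. ennpowr (a i) (1 - \<Theta>) * ennpowr (b i) \<Theta>) \<le> ennpowr \<dots> (1 / r)"
      using False r unfolding seq_qnorm_def by (auto simp: r_def intro!: ennpowr_mono)
    also have "\<dots> = ennpowr (seq_qnorm p0 a) (1 - \<Theta>) * ennpowr (seq_qnorm p1 b) \<Theta>"
      using fin r r01
      by (simp add: seq_qnorm_def r0_def[symmetric] r1_def[symmetric] ennpowr_mult ennpowr_ennpowr \<alpha>_def \<beta>_def)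
    finally show ?thesis .
  next
    case inf1
    have r0: "0 < r0" "r1 = 0"
      using inf1 p01 enn2real_pos by (auto simp: r0_def r1_def)
    \<comment> \<open>Division by \<open>r1 = 0\<close> gives 0, so only the term with
      \<open>r0\<close> is left in the exponent relation.\<close>
    then have r0_eq: "r0 = (1 - \<Theta>) * r"
      using rel' r \<Theta> by (auto simp: field_simps)
    define B where "B = ennpowr (seq_qnorm p1 b) \<Theta>"
    have "seq_qnorm p (\<lambda>i. ennpowr (a i) (1 - \<Theta>) * ennpowr (b i) \<Theta>)
      \<le> seq_qnorm p (\<lambda>i. B * ennpowr (a i) (1 - \<Theta>))"
      using \<Theta> p01 by (intro seq_qnorm_mono)
        (auto simp: B_def mult.commute intro!: mult_mono ennpowr_mono le_seq_qnorm)
    also have "\<dots> = B * ennpowr (seq_qnorm p0 a) (1 - \<Theta>)"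
      using rel(1) False inf1 r r0 \<Theta>
      by (simp add: seq_qnorm_cmult) (simp add: seq_qnorm_def r_def[symmetric] r0_def[symmetric]
          ennpowr_ennpowr r0_eq)
    finally show ?thesis
      by (simp add: B_def mult.commute)
  next
    case inf0
    have r1: "0 < r1" "r0 = 0"
      using inf0 p01 enn2real_pos by (auto simp: r0_def r1_def)
    then have r1_eq: "r1 = \<Theta> * r"
      using rel' r \<Theta> by (auto simp: field_simps)
    define A where "A = ennpowr (seq_qnorm p0 a) (1 - \<Theta>)"
    have "seq_qnorm p (\<lambda>i. ennpowr (a i) (1 - \<Theta>) * ennpowr (b i) \<Theta>)
      \<le> seq_qnorm p (\<lambda>i. A * ennpowr (b i) \<Theta>)"
      using \<Theta> p01 by (intro seq_qnorm_mono)
        (auto simp: A_def intro!: mult_mono ennpowr_mono le_seq_qnorm)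
    also have "\<dots> = A * ennpowr (seq_qnorm p1 b) \<Theta>"
      using rel(1) False inf0 r r1 \<Theta>
      by (simp add: seq_qnorm_cmult) (simp add: seq_qnorm_def r_def[symmetric] r1_def[symmetric]
          ennpowr_ennpowr r1_eq)
    finally show ?thesis
      by (simp add: A_def)
  qed
qed

section \<open>Calderon products of weighted mixed sequence spaces\<close>

text \<open>Raising the entries to the power p / p0 carries l_p into l_p0 and raises the quasi-norm
  to the same power. For p = p0 = \<infinity> the quotient is read as 1; for p finite and p0 =
  \<infinity> it is 0.\<close>

lemma seq_qnorm_powr_le:
  assumes p: "0 < p" "0 < p0" "p = top \<Longrightarrow> p0 = top"
    and a: "\<And>i. 0 \<le> a i" and A: "0 \<le> A" "seq_qnorm p (\<lambda>i. ennreal (a i)) = ennreal A"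
  defines "g \<equiv> if p = top then 1 else enn2real p / enn2real p0"
  shows "seq_qnorm p0 (\<lambda>i. ennreal (a i powr g)) \<le> ennreal (A powr g)"
proof -
  have le: "a i \<le> A" for i
    using le_seq_qnorm[OF p(1), of "\<lambda>i. ennreal (a i)" i] A by simp
  consider "p = top" "p0 = top" | "p \<noteq> top" "p0 = top" | "p \<noteq> top" "p0 \<noteq> top"
    using p(3) by blast
  then show ?thesis
  proof cases
    case 1
    then show ?thesis
      using a A le by (auto simp: seq_qnorm_le_iff_top g_def intro!: ennreal_leI powr_mono2)
  next
    case 2
    \<comment> \<open>Here \<open>g = 0\<close>, and \<open>x powr 0\<close> is 0 at
      \<open>x = 0\<close> and 1 elsewhere; \<open>A = 0\<close> forces
      \<open>a i = 0\<close>.\<close>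
    then have "a i powr g \<le> A powr g" for i
      using le[of i] a[of i] by (cases "a i = 0") (auto simp: g_def)
    then show ?thesis
      using 2 by (auto simp: seq_qnorm_le_iff_top intro!: ennreal_leI)
  next
    case 3
    define r r0 where "r = enn2real p" and "r0 = enn2real p0"
    have r: "0 < r" "0 < r0"
      using p 3 enn2real_pos by (auto simp: r_def r0_def)
    have "ennpowr (ennpowr (\<integral>\<^sup>+i. ennpowr (ennreal (a i)) r \<partial>count_space UNIV) (1 / r)) (r / r0)
      = ennpowr (ennreal A) (r / r0)"
      using A(2) 3 by (simp add: seq_qnorm_def r_def)
    then show ?thesis
      using 3 r a A by (simp add: seq_qnorm_def g_def r_def[symmetric] r0_def[symmetric]
          ennpowr_ennpowr ennpowr_ennreal powr_powr)
  qed
qed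

definition mixed_qnorm ::
    "ennreal \<Rightarrow> ennreal \<Rightarrow> ('i \<times> 'k \<Rightarrow> real) \<Rightarrow> ('i \<times> 'k \<Rightarrow> complex) \<Rightarrow> ennreal" where
  "mixed_qnorm p q v u = seq_qnorm q (\<lambda>j. seq_qnorm p (\<lambda>k. ennreal (v (j, k) * cmod (u (j, k)))))"

definition mixed_space :: "ennreal \<Rightarrow> ennreal \<Rightarrow> ('i \<times> 'k \<Rightarrow> real) \<Rightarrow> ('i \<times> 'k) qspace" where
  "mixed_space p q v = ({u. mixed_qnorm p q v u < \<infinity>}, mixed_qnorm p q v)"

text \<open>Lets a weight be replaced by a comparable one, once for each direction of the
  equivalence.\<close>

lemma mixed_qnorm_weight_le:
  assumes "0 < p" "0 < q" "0 \<le> C" and "\<And>x. 0 \<le> v' x" "\<And>x. v x \<le> C * v' x"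
  shows "mixed_qnorm p q v u \<le> ennreal C * mixed_qnorm p q v' u"
proof -
  have "mixed_qnorm p q v u \<le>
      seq_qnorm q (\<lambda>j. seq_qnorm p (\<lambda>k. ennreal C * ennreal (v' (j, k) * cmod (u (j, k)))))"
    unfolding mixed_qnorm_def using assms
    by (intro seq_qnorm_mono) (auto simp: ennreal_mult[symmetric] mult.assoc[symmetric]
        intro!: ennreal_leI mult_right_mono)
  then show ?thesis
    using assms by (simp add: seq_qnorm_cmult mixed_qnorm_def)
qed

section \<open>The Calderon product of two mixed spaces\<close>

context
  fixes \<Theta> :: real and p p0 p1 q q0 q1 :: ennreal
  assumes \<Theta>: "0 < \<Theta>" "\<Theta> < 1"
    and pq_pos: "0 < p0" "0 < p1" "0 < q0" "0 < q1"
    and p_eq: "1 / p = ennreal (1 - \<Theta>) / p0 + ennreal \<Theta> / p1"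
    and q_eq: "1 / q = ennreal (1 - \<Theta>) / q0 + ennreal \<Theta> / q1"
begin

lemmas p_rel = exponent_relation[OF \<Theta> pq_pos(1,2) p_eq]
lemmas q_rel = exponent_relation[OF \<Theta> pq_pos(3,4) q_eq]

text \<open>Hoelder's inequality is used twice: in \<open>k\<close> on every level, then in
  \<open>j\<close> for the quasi-norms of the levels.\<close>

lemma mixed_qnorm_Holder:
  fixes v0 v1 :: "'i \<times> 'k \<Rightarrow> real"
  assumes v: "\<And>x. 0 \<le> v0 x" "\<And>x. 0 \<le> v1 x"
    and f: "\<And>x. cmod (f x) \<le> cmod (f0 x) powr (1 - \<Theta>) * cmod (f1 x) powr \<Theta>"
  shows "mixed_qnorm p q (\<lambda>x. v0 x powr (1 - \<Theta>) * v1 x powr \<Theta>) f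
    \<le> ennpowr (mixed_qnorm p0 q0 v0 f0) (1 - \<Theta>) * ennpowr (mixed_qnorm p1 q1 v1 f1) \<Theta>"
proof -
  have "mixed_qnorm p q (\<lambda>x. v0 x powr (1 - \<Theta>) * v1 x powr \<Theta>) f \<le>
    seq_qnorm q (\<lambda>j. seq_qnorm p (\<lambda>k. ennpowr (ennreal (v0 (j, k) * cmod (f0 (j, k)))) (1 - \<Theta>)
      * ennpowr (ennreal (v1 (j, k) * cmod (f1 (j, k)))) \<Theta>))"
    unfolding mixed_qnorm_def
  proof (intro seq_qnorm_mono)
    fix j :: 'i and k :: 'k
    let ?x = "(j, k)"
    have "v0 ?x powr (1 - \<Theta>) * v1 ?x powr \<Theta> * cmod (f ?x)
      \<le> v0 ?x powr (1 - \<Theta>) * v1 ?x powr \<Theta> * (cmod (f0 ?x) powr (1 - \<Theta>) * cmod (f1 ?x) powr \<Theta>)"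
      using f by (intro mult_left_mono) auto
    then show "ennreal (v0 ?x powr (1 - \<Theta>) * v1 ?x powr \<Theta> * cmod (f ?x))
      \<le> ennpowr (ennreal (v0 ?x * cmod (f0 ?x))) (1 - \<Theta>) * ennpowr (ennreal (v1 ?x * cmod (f1 ?x))) \<Theta>"
      using v by (simp add: ennpowr_ennreal ennreal_mult[symmetric] powr_mult mult_ac ennreal_leI)
  qed
  also have "\<dots> \<le> seq_qnorm q (\<lambda>j.
      ennpowr (seq_qnorm p0 (\<lambda>k. ennreal (v0 (j, k) * cmod (f0 (j, k))))) (1 - \<Theta>)
      * ennpowr (seq_qnorm p1 (\<lambda>k. ennreal (v1 (j, k) * cmod (f1 (j, k))))) \<Theta>)"
    by (intro seq_qnorm_mono seq_qnorm_Holder \<Theta> pq_pos p_eq)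
  also have "\<dots> \<le> ennpowr (mixed_qnorm p0 q0 v0 f0) (1 - \<Theta>) * ennpowr (mixed_qnorm p1 q1 v1 f1) \<Theta>"
    unfolding mixed_qnorm_def by (intro seq_qnorm_Holder \<Theta> pq_pos q_eq)
  finally show ?thesis .
qed

text \<open>Let \<open>a\<close> be the weighted modulus of \<open>f\<close>, \<open>L j\<close> its
  quasi-norm on level \<open>j\<close> and \<open>N\<close> the total quasi-norm. The factor
  \<open>f0\<close> is chosen with weighted modulus
  \<open>a powr (p / p0) * L j powr (q / q0 - p / p0)\<close>, and \<open>f1\<close> likewise. Its
  quasi-norm on level \<open>j\<close> is then at most \<open>L j powr (q / q0)\<close>, and the
  total one at most \<open>N powr (q / q0)\<close>. Weighted by \<open>1 - \<Theta>\<close> and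
  \<open>\<Theta>\<close>, the quotients p / p0, p / p1 and q / q0, q / q1 average to 1, so the
  product gives back \<open>f\<close> and \<open>N\<close>.\<close>

lemma mixed_qnorm_factorization:
  fixes v0 v1 :: "'i \<times> 'k \<Rightarrow> real" and f :: "'i \<times> 'k \<Rightarrow> complex"
  assumes v: "\<And>x. 0 < v0 x" "\<And>x. 0 < v1 x"
    and fin: "mixed_qnorm p q (\<lambda>x. v0 x powr (1 - \<Theta>) * v1 x powr \<Theta>) f < \<infinity>"
  obtains f0 f1 where "\<And>x. cmod (f x) = cmod (f0 x) powr (1 - \<Theta>) * cmod (f1 x) powr \<Theta>"
    and "mixed_qnorm p0 q0 v0 f0 < \<infinity>" "mixed_qnorm p1 q1 v1 f1 < \<infinity>"
    and "ennpowr (mixed_qnorm p0 q0 v0 f0) (1 - \<Theta>) * ennpowr (mixed_qnorm p1 q1 v1 f1) \<Theta>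
      \<le> mixed_qnorm p q (\<lambda>x. v0 x powr (1 - \<Theta>) * v1 x powr \<Theta>) f"
proof -
  define a where "a x = v0 x powr (1 - \<Theta>) * v1 x powr \<Theta> * cmod (f x)" for x
  define L where "L j = enn2real (seq_qnorm p (\<lambda>k. ennreal (a (j, k))))" for j
  define N where "N = enn2real (mixed_qnorm p q (\<lambda>x. v0 x powr (1 - \<Theta>) * v1 x powr \<Theta>) f)"
  have a0: "0 \<le> a x" for x
    by (simp add: a_def)
  have L0: "0 \<le> L j" for j
    by (simp add: L_def)
  have N0: "0 \<le> N"
    by (simp add: N_def)
  have fin': "seq_qnorm q (\<lambda>j. seq_qnorm p (\<lambda>k. ennreal (a (j, k)))) < top"
    using fin by (simp add: mixed_qnorm_def a_def)
  have L: "seq_qnorm p (\<lambda>k. ennreal (a (j, k))) = ennreal (L j)" for j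
    using le_seq_qnorm[OF q_rel(1), of "\<lambda>j. seq_qnorm p (\<lambda>k. ennreal (a (j, k)))" j] fin'
    by (simp add: L_def le_less_trans)
  have N: "seq_qnorm q (\<lambda>j. ennreal (L j)) = ennreal N"
    using fin' unfolding L[symmetric] by (simp add: N_def mixed_qnorm_def a_def)
  have aL: "a (j, k) \<le> L j" for j k
    using le_seq_qnorm[OF p_rel(1), of "\<lambda>k. ennreal (a (j, k))" k] L0 by (simp add: L)

  \<comment> \<open>\<open>g r\<close> and \<open>d r\<close> stand for p / r and q / r. If p =
    \<infinity>, then p0 = p1 = \<infinity>, and the value 1 keeps the averaging identity
    \<open>g1\<close> valid; similarly for q.\<close>
  define g where "g r = (if p = top then 1 else enn2real p / enn2real r)" for r
  define d where "d r = (if q = top then 1 else enn2real q / enn2real r)" for r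
  have g1: "(1 - \<Theta>) * g p0 + \<Theta> * g p1 = 1"
    using p_rel(3) enn2real_pos[OF p_rel(1)]
    by (cases "p = top") (auto simp: g_def divide_simps split: if_splits, simp add: algebra_simps)
  have d1: "(1 - \<Theta>) * d q0 + \<Theta> * d q1 = 1"
    using q_rel(3) enn2real_pos[OF q_rel(1)]
    by (cases "q = top") (auto simp: d_def divide_simps split: if_splits, simp add: algebra_simps)
  define h where "h u r s x = complex_of_real (a x powr g r * L (fst x) powr (d s - g r) / u x)"
    for u :: "'i \<times> 'k \<Rightarrow> real" and r s x

  \<comment> \<open>One bound for a generic weight \<open>u\<close> and generic exponents serves
    both factors.\<close>
  have bound: "mixed_qnorm r s u (h u r s) \<le> ennreal (N powr d s)"
    if u: "\<And>x. 0 < u x" and r: "0 < r" "p = top \<Longrightarrow> r = top" and s: "0 < s" "q = top \<Longrightarrow> s = top"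
    for u r s
  proof -
    have "mixed_qnorm r s u (h u r s) = seq_qnorm s (\<lambda>j. seq_qnorm r
        (\<lambda>k. ennreal (L j powr (d s - g r)) * ennreal (a (j, k) powr g r)))"
      unfolding mixed_qnorm_def h_def using u
      by (intro arg_cong[of _ _ "seq_qnorm _"] ext)
        (simp add: norm_mult norm_divide ennreal_mult[symmetric] abs_of_pos less_imp_neq[symmetric] mult.commute)
    also have "\<dots> \<le> seq_qnorm s (\<lambda>j. ennreal (L j powr d s))"
    proof (rule seq_qnorm_mono)
      fix j
      have "seq_qnorm r (\<lambda>k. ennreal (a (j, k) powr g r)) \<le> ennreal (L j powr g r)"
        unfolding g_def using p_rel(1) r a0 L0 L by (intro seq_qnorm_powr_le) auto
      then have "seq_qnorm r (\<lambda>k. ennreal (L j powr (d s - g r)) * ennreal (a (j, k) powr g r))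
        \<le> ennreal (L j powr (d s - g r)) * ennreal (L j powr g r)"
        using r by (auto simp: seq_qnorm_cmult intro!: mult_left_mono)
      \<comment> \<open>True also for \<open>L j = 0\<close>, where all powers vanish.\<close>
      also have "\<dots> = ennreal (L j powr d s)"
        by (simp add: ennreal_mult[symmetric] powr_add[symmetric])
      finally show "seq_qnorm r (\<lambda>k. ennreal (L j powr (d s - g r)) * ennreal (a (j, k) powr g r))
        \<le> ennreal (L j powr d s)" .
    qed
    also have "\<dots> \<le> ennreal (N powr d s)"
      unfolding d_def using q_rel(1) s L0 N0 N by (intro seq_qnorm_powr_le) auto
    finally show ?thesis .
  qed
  note b0 = bound[of v0 p0 q0, OF v(1) pq_pos(1) _ pq_pos(3)]
  note b1 = bound[of v1 p1 q1, OF v(2) pq_pos(2) _ pq_pos(4)]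
  have b0: "mixed_qnorm p0 q0 v0 (h v0 p0 q0) \<le> ennreal (N powr d q0)"
    using b0 p_rel(2) q_rel(2) by blast
  have b1: "mixed_qnorm p1 q1 v1 (h v1 p1 q1) \<le> ennreal (N powr d q1)"
    using b1 p_rel(2) q_rel(2) by blast

  show ?thesis
  proof (rule that[of "h v0 p0 q0" "h v1 p1 q1"])
    fix x :: "'i \<times> 'k"
    obtain j k where x: "x = (j, k)"
      by force
    show "cmod (f x) = cmod (h v0 p0 q0 x) powr (1 - \<Theta>) * cmod (h v1 p1 q1 x) powr \<Theta>"
    proof (cases "f x = 0")
      case True
      then show ?thesis
        by (simp add: h_def a_def)
    next
      case False
      then have pos: "0 < a x" "0 < L j"
        using v[of x] aL[of j k] less_le_trans[of 0 "a x" "L j"] by (auto simp: a_def x)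
      \<comment> \<open>By \<open>g1\<close> and \<open>d1\<close> the total exponent of
        \<open>a x\<close> is 1 and that of \<open>L j\<close> is 0.\<close>
      have "(a x powr g p0 * L j powr (d q0 - g p0)) powr (1 - \<Theta>)
          * (a x powr g p1 * L j powr (d q1 - g p1)) powr \<Theta>
        = a x powr ((1 - \<Theta>) * g p0 + \<Theta> * g p1)
          * L j powr (((1 - \<Theta>) * d q0 + \<Theta> * d q1) - ((1 - \<Theta>) * g p0 + \<Theta> * g p1))"
        by (simp add: powr_mult powr_powr powr_add[symmetric] mult_ac)
          (simp add: powr_add powr_diff algebra_simps)
      also have "\<dots> = a x"
        using pos by (simp add: g1 d1)
      finally show ?thesis
        using v[of x] by (simp add: h_def x norm_mult norm_divide powr_divide abs_mult)
          (simp add: a_def x field_simps)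
    qed
  next
    show "mixed_qnorm p0 q0 v0 (h v0 p0 q0) < \<infinity>" "mixed_qnorm p1 q1 v1 (h v1 p1 q1) < \<infinity>"
      using b0 b1 by (auto elim: le_less_trans)
    have "ennpowr (mixed_qnorm p0 q0 v0 (h v0 p0 q0)) (1 - \<Theta>) * ennpowr (mixed_qnorm p1 q1 v1 (h v1 p1 q1)) \<Theta>
      \<le> ennpowr (ennreal (N powr d q0)) (1 - \<Theta>) * ennpowr (ennreal (N powr d q1)) \<Theta>"
      using \<Theta> b0 b1 by (intro mult_mono ennpowr_mono) auto
    also have "\<dots> = ennreal (N powr ((1 - \<Theta>) * d q0 + \<Theta> * d q1))"
      by (simp add: ennpowr_ennreal powr_powr powr_add mult_ac ennreal_mult)
    also have "\<dots> = ennreal N"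
      using d1 N0 by simp
    also have "\<dots> = mixed_qnorm p q (\<lambda>x. v0 x powr (1 - \<Theta>) * v1 x powr \<Theta>) f"
      using fin by (simp add: N_def)
    finally show "ennpowr (mixed_qnorm p0 q0 v0 (h v0 p0 q0)) (1 - \<Theta>) * ennpowr (mixed_qnorm p1 q1 v1 (h v1 p1 q1)) \<Theta>
      \<le> mixed_qnorm p q (\<lambda>x. v0 x powr (1 - \<Theta>) * v1 x powr \<Theta>) f" .
  qed
qed

text \<open>For the product weight the infimum equals the mixed quasi-norm exactly: Hoelder's
  inequality bounds it from below and the explicit factorization from above. The constants of the
  equivalence come only from comparing \<open>v\<close> with the product weight.\<close>

theorem calderon_product_mixed_space:
  fixes v0 v1 v :: "'i \<times> 'k \<Rightarrow> real"
  assumes v: "\<And>x. 0 < v0 x" "\<And>x. 0 < v1 x" and C: "0 < C"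
    and le: "\<And>x. v x \<le> C * (v0 x powr (1 - \<Theta>) * v1 x powr \<Theta>)"
    and ge: "\<And>x. v0 x powr (1 - \<Theta>) * v1 x powr \<Theta> \<le> C * v x"
  shows "equal_equivalent_qnorms
    (calderon_product (count_space UNIV) \<Theta> (mixed_space p0 q0 v0) (mixed_space p1 q1 v1))
    (mixed_space p q v)"
proof -
  define X where "X = calderon_product (count_space UNIV) \<Theta> (mixed_space p0 q0 v0) (mixed_space p1 q1 v1)"
  define P where "P f = {(f0, f1). mixed_qnorm p0 q0 v0 f0 < \<infinity> \<and> mixed_qnorm p1 q1 v1 f1 < \<infinity> \<and>
     (\<forall>x. cmod (f x) \<le> cmod (f0 x) powr (1 - \<Theta>) * cmod (f1 x) powr \<Theta>)}" for f
  define F where "F = (\<lambda>(f0, f1). ennpowr (mixed_qnorm p0 q0 v0 f0) (1 - \<Theta>) * ennpowr (mixed_qnorm p1 q1 v1 f1) \<Theta>)"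
  define u where "u x = v0 x powr (1 - \<Theta>) * v1 x powr \<Theta>" for x
  \<comment> \<open>For the counting measure, almost everywhere means everywhere.\<close>
  have snd_X: "snd X f = (INF z \<in> P f. F z)" for f
    by (simp add: X_def calderon_product_def mixed_space_def Let_def P_def F_def AE_count_space)
  have fst_X: "f \<in> fst X \<longleftrightarrow> snd X f < \<infinity>" for f
    by (simp add: X_def calderon_product_def Let_def)
  have v_nonneg: "0 \<le> v x" for x
    using order_trans[OF _ ge, of 0 x] C by (simp add: zero_le_mult_iff)
  have exact: "snd X f = mixed_qnorm p q u f" for f
  proof (rule antisym)
    show "mixed_qnorm p q u f \<le> snd X f"
      unfolding snd_X
    proof (rule INF_greatest)
      fix z assume "z \<in> P f"
      moreover obtain f0 f1 where "z = (f0, f1)"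
        by force
      ultimately show "mixed_qnorm p q u f \<le> F z"
        using mixed_qnorm_Holder[of v0 v1 f f0 f1] v
        by (simp add: u_def[abs_def] F_def P_def less_imp_le del: split_paired_All)
    qed
    show "snd X f \<le> mixed_qnorm p q u f"
    proof (cases "mixed_qnorm p q u f < \<infinity>")
      case True
      then obtain f0 f1 where "\<And>x. cmod (f x) = cmod (f0 x) powr (1 - \<Theta>) * cmod (f1 x) powr \<Theta>"
        "mixed_qnorm p0 q0 v0 f0 < \<infinity>" "mixed_qnorm p1 q1 v1 f1 < \<infinity>" "F (f0, f1) \<le> mixed_qnorm p q u f"
        using mixed_qnorm_factorization[of v0 v1 f] v unfolding u_def[abs_def] F_def case_prod_conv by blast
      then have "(f0, f1) \<in> P f" "F (f0, f1) \<le> mixed_qnorm p q u f"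
        by (simp_all add: P_def del: split_paired_All)
      then show ?thesis
        unfolding snd_X by (rule INF_lower2)
    qed (simp add: less_top[symmetric])
  qed
  have le1: "mixed_qnorm p q v f \<le> ennreal C * snd X f" for f
    unfolding exact using C le v p_rel(1) q_rel(1)
    by (intro mixed_qnorm_weight_le) (auto simp: u_def)
  have le2: "snd X f \<le> ennreal C * mixed_qnorm p q v f" for f
    unfolding exact using C ge v_nonneg p_rel(1) q_rel(1)
    by (intro mixed_qnorm_weight_le) (auto simp: u_def)
  have le3: "ennreal (1 / C) * snd X f \<le> mixed_qnorm p q v f" for f
  proof -
    have "ennreal (1 / C) * snd X f \<le> ennreal (1 / C) * (ennreal C * mixed_qnorm p q v f)"
      using le2 by (intro mult_left_mono) auto
    also have "\<dots> = mixed_qnorm p q v f"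
      using C by (simp add: mult.assoc[symmetric] ennreal_mult[symmetric])
    finally show ?thesis .
  qed
  have "fst X = fst (mixed_space p q v)"
  proof (intro set_eqI iffI)
    fix f
    show "f \<in> fst (mixed_space p q v)" if "f \<in> fst X"
      using that le1[of f] unfolding fst_X
      by (auto simp: mixed_space_def elim!: le_less_trans simp: ennreal_mult_less_top)
    show "f \<in> fst X" if "f \<in> fst (mixed_space p q v)"
      using that le2[of f] unfolding fst_X
      by (auto simp: mixed_space_def elim!: le_less_trans simp: ennreal_mult_less_top)
  qed
  then show ?thesis
    unfolding equal_equivalent_qnorms_def X_def[symmetric] using C le1 le3
    by (intro conjI exI[of _ "1 / C"] exI[of _ C]) (auto simp: mixed_space_def)
qed

end

section \<open>Local Muckenhoupt weights on balls\<close>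

abbreviation integral_over :: "(real ^ 'd) set \<Rightarrow> (real ^ 'd \<Rightarrow> real) \<Rightarrow> ennreal" where
  "integral_over S w \<equiv> \<integral>\<^sup>+x\<in>S. ennreal (w x) \<partial>lebesgue"

text \<open>Real valued, so that powers and cancellation take place in the reals. An infinite
  integral would be sent to 0, hence the finiteness hypotheses below.\<close>

definition mass :: "(real ^ 'd \<Rightarrow> real) \<Rightarrow> (real ^ 'd) set \<Rightarrow> real" where
  "mass w S = enn2real (integral_over S w)"

lemma mass_nonneg [simp]: "0 \<le> mass w S"
  by (simp add: mass_def)

lemma ennreal_mass: "integral_over S w < \<infinity> \<Longrightarrow> ennreal (mass w S) = integral_over S w"
  by (simp add: mass_def)

lemma mass_mono:
  assumes "S \<subseteq> T" "integral_over T w < \<infinity>"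
  shows "mass w S \<le> mass w T"
  unfolding mass_def using assms
  by (intro enn2real_mono nn_integral_mono) (auto simp: indicator_def)

lemma mass_pos:
  assumes [measurable]: "w \<in> borel_measurable lebesgue" "S \<in> sets lebesgue"
    and pos: "AE x in lebesgue. 0 < w x" "0 < emeasure lebesgue S" and fin: "integral_over S w < \<infinity>"
  shows "0 < mass w S"
proof -
  have "integral_over S w \<noteq> 0"
  proof
    assume "integral_over S w = 0"
    then have "AE x in lebesgue. ennreal (w x) * indicator S x = 0"
      by (subst (asm) nn_integral_0_iff_AE) auto
    with pos(1) have "AE x in lebesgue. x \<notin> S"
      by eventually_elim (auto split: split_indicator_asm)
    then have "emeasure lebesgue S = 0"
      by (subst (asm) AE_iff_measurable[of S]) auto
    with pos(2) show False
      by simp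
  qed
  with fin show ?thesis
    by (simp add: mass_def enn2real_positive_iff zero_less_iff_neq_zero)
qed

text \<open>A bounded set lies in a compact ball, on which a weight is integrable.\<close>

lemma weight_integral_finite:
  assumes w: "weight w" and S: "bounded S"
  shows "integral_over S w < \<infinity>"
proof -
  from S obtain r where r: "S \<subseteq> cball 0 r"
    using bounded_iff[of S] by (auto simp: subset_iff)
  have "set_integrable lebesgue (cball 0 r) w"
    using w by (simp add: weight_def)
  then have "(\<integral>\<^sup>+x. norm (indicator (cball 0 r) x *\<^sub>R w x) \<partial>lebesgue) < \<infinity>"
    unfolding set_integrable_def by (simp add: integrable_iff_bounded)
  moreover have "integral_over S w \<le> (\<integral>\<^sup>+x. norm (indicator (cball 0 r) x *\<^sub>R w x) \<partial>lebesgue)"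
    using r by (intro nn_integral_mono) (auto simp: indicator_def intro!: ennreal_leI)
  ultimately show ?thesis
    by (rule le_less_trans[rotated])
qed

text \<open>Since \<open>h\<close> is only dominated, the same statement gives upper bounds for a
  product of weights and, with \<open>h = 1\<close>, lower bounds for the masses of the
  factors.\<close>

lemma mass_Holder:
  fixes f g :: "real ^ 'd \<Rightarrow> real"
  assumes [measurable]: "f \<in> borel_measurable lebesgue" "g \<in> borel_measurable lebesgue" "S \<in> sets lebesgue"
    and nonneg: "\<And>x. 0 \<le> f x" "\<And>x. 0 \<le> g x"
    and fin: "integral_over S f < \<infinity>" "integral_over S g < \<infinity>"
    and ab: "0 < a" "0 < b" "a + b = 1"
    and h: "AE x in lebesgue. h x \<le> f x powr a * g x powr b"
  shows "integral_over S h < \<infinity>" and "mass h S \<le> mass f S powr a * mass g S powr b"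
proof -
  have "integral_over S h \<le> (\<integral>\<^sup>+x. ennpowr (ennreal (f x) * indicator S x) a
      * ennpowr (ennreal (g x) * indicator S x) b \<partial>lebesgue)"
  proof (rule nn_integral_mono_AE, use h in eventually_elim)
    case (elim x)
    then show ?case
      using nonneg
      by (auto simp: ennpowr_ennreal ennreal_mult[symmetric] ennreal_leI split: split_indicator)
  qed
  also have "\<dots> \<le> ennpowr (integral_over S f) a * ennpowr (integral_over S g) b"
    by (intro nn_integral_Holder ab) auto
  also have "\<dots> = ennreal (mass f S powr a * mass g S powr b)"
    by (simp add: ennreal_mass[OF fin(1), symmetric] ennreal_mass[OF fin(2), symmetric]
        ennpowr_ennreal ennreal_mult)
  finally have *: "integral_over S h \<le> ennreal (mass f S powr a * mass g S powr b)" .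
  then show "integral_over S h < \<infinity>"
    by (rule le_less_trans) simp
  from enn2real_mono[OF *] show "mass h S \<le> mass f S powr a * mass g S powr b"
    by (simp add: mass_def[of h])
qed

section \<open>Volumes of balls and the Muckenhoupt condition in terms of masses\<close>

lemma mass_const_1_ball:
  fixes x :: "real ^ 'd"
  shows "mass (\<lambda>_. 1) (ball x \<rho>) = measure lebesgue (ball x \<rho>)"
  by (simp add: mass_def measure_def)

lemma measure_lebesgue_ball:
  fixes x :: "real ^ 'd"
  assumes "0 \<le> \<rho>"
  shows "measure lebesgue (ball x \<rho>) = unit_ball_vol (real CARD('d)) * \<rho> ^ CARD('d)"
  using content_ball[OF assms, of x] by simp

lemma emeasure_lebesgue_ball:
  fixes x :: "real ^ 'd"
  shows "emeasure lebesgue (ball x \<rho>) = ennreal (measure lebesgue (ball x \<rho>))"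
  by (intro emeasure_eq_measure2) (simp add: emeasure_lborel_ball_finite)

text \<open>The second factor in the condition defining \<^term>\<open>A_loc r\<close> is an average of this weight.\<close>

definition dual_weight :: "real \<Rightarrow> (real ^ 'd \<Rightarrow> real) \<Rightarrow> real ^ 'd \<Rightarrow> real" where
  "dual_weight r w x = w x powr (- 1 / (r - 1))"

lemma A_locD:
  assumes "w \<in> A_loc r"
  shows "weight w" "AE x in lebesgue. 0 < w x" "w \<in> borel_measurable lebesgue" "0 \<le> w x"
  using assms by (auto simp: A_loc_def weight_def)

lemma dual_weight_measurable [measurable (raw)]:
  "w \<in> borel_measurable lebesgue \<Longrightarrow> dual_weight r w \<in> borel_measurable lebesgue"
  unfolding dual_weight_def[abs_def] by measurable

text \<open>The Muckenhoupt condition is raised to the power \<open>r\<close> and cleared of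
  denominators; the two averages contribute \<open>v * v powr (r - 1) = v powr r\<close>, where
  \<open>v\<close> is the volume of the ball.\<close>

lemma A_loc_mass_bound:
  fixes w :: "real ^ 'd \<Rightarrow> real"
  assumes w: "w \<in> A_loc r" and r: "1 < r"
  obtains C where "0 < C"
    and "\<And>x \<rho>. 0 < \<rho> \<Longrightarrow> emeasure lebesgue (ball x \<rho>) \<le> 1 \<Longrightarrow> integral_over (ball x \<rho>) (dual_weight r w) < \<infinity>"
    and "\<And>x \<rho>. 0 < \<rho> \<Longrightarrow> emeasure lebesgue (ball x \<rho>) \<le> 1 \<Longrightarrow>
      mass w (ball x \<rho>) * mass (dual_weight r w) (ball x \<rho>) powr (r - 1)
        \<le> C * measure lebesgue (ball x \<rho>) powr r"
proof -
  note [measurable] = A_locD(3)[OF w]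
  define \<B> where "\<B> = {ball x \<rho> | (x :: real ^ 'd) \<rho>. 0 < \<rho> \<and> emeasure lebesgue (ball x \<rho>) \<le> 1}"
  define S where "S = (SUP B \<in> \<B>. ennpowr (average B w) (1 / r) *
          ennpowr (average B (dual_weight r w)) ((r - 1) / r))"
  \<comment> \<open>The exponents -r'/r and 1/r' of the definition for r' = r / (r - 1), in the form
    that fits \<open>dual_weight\<close>.\<close>
  have "- (r / (r - 1)) / r = - 1 / (r - 1)" "1 / (r / (r - 1)) = (r - 1) / r"
    using r by (auto simp: field_simps)
  then have "S < \<infinity>"
    using w unfolding A_loc_def Let_def dual_weight_def[abs_def] S_def \<B>_def by simp
  \<comment> \<open>Adding 1 makes the constant positive even if \<open>S = 0\<close>.\<close>
  define D where "D = enn2real S + 1"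
  have D: "0 < D" "S \<le> ennreal D"
    using \<open>S < \<infinity>\<close> by (cases S; auto simp: D_def add_nonneg_pos)+
  have main: "integral_over (ball x \<rho>) (dual_weight r w) < \<infinity> \<and>
      mass w (ball x \<rho>) * mass (dual_weight r w) (ball x \<rho>) powr (r - 1)
        \<le> D powr r * measure lebesgue (ball x \<rho>) powr r"
    if "0 < \<rho>" "emeasure lebesgue (ball x \<rho>) \<le> 1" for x \<rho>
  proof -
    let ?B = "ball x \<rho>"
    define v where "v = measure lebesgue ?B"
    have v: "0 < v" "emeasure lebesgue ?B = ennreal v"
      using that by (auto simp: v_def emeasure_lebesgue_ball)
    have fin: "integral_over ?B w < \<infinity>"
      by (rule weight_integral_finite[OF A_locD(1)[OF w]]) simp
    define a where "a = mass w ?B"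
    have a: "0 < a" "integral_over ?B w = ennreal a"
      using mass_pos[OF A_locD(3)[OF w] _ A_locD(2)[OF w] _ fin] v ennreal_mass[OF fin]
      by (auto simp: a_def)
    have "ennpowr (average ?B w) (1 / r) * ennpowr (average ?B (dual_weight r w)) ((r - 1) / r) \<le> S"
      unfolding S_def \<B>_def using that by (intro SUP_upper) auto
    also note D(2)
    finally have le: "ennpowr (ennreal (a / v)) (1 / r)
        * ennpowr (integral_over ?B (dual_weight r w) / ennreal v) ((r - 1) / r) \<le> ennreal D"
      using a v by (simp add: average_def divide_ennreal)
    \<comment> \<open>Since \<open>a > 0\<close>, an infinite dual integral would make the left side
      of \<open>le\<close> infinite.\<close>
    have fin_dual: "integral_over ?B (dual_weight r w) < \<infinity>"
    proof (rule ccontr)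
      assume "\<not> integral_over ?B (dual_weight r w) < \<infinity>"
      then have "integral_over ?B (dual_weight r w) = top"
        by (simp add: less_top[symmetric])
      then show False
        using le a v by (simp add: ennreal_top_divide ennreal_mult_top top_unique ennreal_mult_eq_top_iff)
    qed
    define s where "s = mass (dual_weight r w) ?B"
    have s: "0 \<le> s" "integral_over ?B (dual_weight r w) = ennreal s"
      using ennreal_mass[OF fin_dual] by (simp_all add: s_def)
    have "(a / v) powr (1 / r) * (s / v) powr ((r - 1) / r) \<le> D"
      using le a s v D by (simp add: divide_ennreal ennpowr_ennreal ennreal_mult[symmetric])
    then have "((a / v) powr (1 / r) * (s / v) powr ((r - 1) / r)) powr r \<le> D powr r"
      using r by (intro powr_mono2) auto
    then have "(a / v) * (s / v) powr (r - 1) \<le> D powr r"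
      using r a v s by (simp add: powr_mult powr_powr)
    then have "a * s powr (r - 1) \<le> D powr r * (v * v powr (r - 1))"
      using v s by (simp add: powr_divide field_simps)
    moreover have "v * v powr (r - 1) = v powr r"
      using v by (simp add: powr_diff)
    ultimately show ?thesis
      using fin_dual by (simp add: a_def s_def v_def)
  qed
  show thesis
    by (rule that[of "D powr r"]) (use main D in auto)
qed

text \<open>Let E be the ball about \<open>z\<close> of radius \<open>\<rho>\<close>, B the one of
  twice the radius and \<sigma> the dual weight. Hoelder's inequality for
  \<open>1 = w powr (1 / r) * \<sigma> powr ((r - 1) / r)\<close> on E gives |E|^r \<le> w(E)
  \<sigma>(E)^(r - 1) \<le> w(E) \<sigma>(B)^(r - 1). Multiplying by w(B) and using the Muckenhoupt
  bound on B yields w(B) |E|^r \<le> C w(E) |B|^r, and B contains the ball about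
  \<open>y\<close>.\<close>

lemma A_loc_doubling:
  fixes w :: "real ^ 'd \<Rightarrow> real"
  assumes w: "w \<in> A_loc r" and r: "1 < r"
  obtains K where "0 < K"
    and "\<And>y z \<rho>. 0 < \<rho> \<Longrightarrow> emeasure lebesgue (ball z (2 * \<rho>)) \<le> 1 \<Longrightarrow> dist y z \<le> \<rho> \<Longrightarrow>
      mass w (ball y \<rho>) \<le> K * mass w (ball z \<rho>)"
proof -
  obtain C where C: "0 < C"
    and fin: "\<And>x \<rho>. 0 < \<rho> \<Longrightarrow> emeasure lebesgue (ball x \<rho>) \<le> 1 \<Longrightarrow> integral_over (ball x \<rho>) (dual_weight r w) < \<infinity>"
    and bd: "\<And>x \<rho>. 0 < \<rho> \<Longrightarrow> emeasure lebesgue (ball x \<rho>) \<le> 1 \<Longrightarrow>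
      mass w (ball x \<rho>) * mass (dual_weight r w) (ball x \<rho>) powr (r - 1)
        \<le> C * measure lebesgue (ball x \<rho>) powr r"
    by (rule A_loc_mass_bound[OF w r]) blast
  note [measurable] = A_locD(3)[OF w]
  \<comment> \<open>The second factor is (|B| / |E|)^r.\<close>
  define K where "K = C * (2 ^ CARD('d)) powr r"
  have "mass w (ball y \<rho>) \<le> K * mass w (ball z \<rho>)"
    if \<rho>: "0 < \<rho>" and le1: "emeasure lebesgue (ball z (2 * \<rho>)) \<le> 1" and dist: "dist y z \<le> \<rho>" for y z \<rho>
  proof -
    let ?E = "ball z \<rho>" and ?B = "ball z (2 * \<rho>)" and ?\<sigma> = "dual_weight r w"
    define v where "v = measure lebesgue ?E"
    have v: "0 < v" "measure lebesgue ?B = 2 ^ CARD('d) * v"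
      using \<rho> measure_lebesgue_ball[of \<rho> z] measure_lebesgue_ball[of "2 * \<rho>" z]
      by (simp_all add: v_def power_mult_distrib)
    have EB: "?E \<subseteq> ?B" "ball y \<rho> \<subseteq> ?B"
    proof -
      show "?E \<subseteq> ?B"
        using \<rho> by (intro subset_ball) simp
      show "ball y \<rho> \<subseteq> ?B"
        using dist by (simp add: ball_subset_ball_iff dist_commute)
    qed
    have fw: "integral_over S w < \<infinity>" if "bounded S" for S
      by (rule weight_integral_finite[OF A_locD(1)[OF w] that])
    have fB: "integral_over ?B ?\<sigma> < \<infinity>"
      using fin[of "2 * \<rho>" z] \<rho> le1 by simp
    have fE: "integral_over ?E ?\<sigma> < \<infinity>"
      using EB by (intro le_less_trans[OF nn_integral_mono fB]) (auto simp: indicator_def)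
    have "AE x in lebesgue. 1 \<le> w x powr (1 / r) * ?\<sigma> x powr ((r - 1) / r)"
      using A_locD(2)[OF w]
    proof eventually_elim
      case (elim x)
      have "- 1 / (r - 1) * ((r - 1) / r) = - 1 / r"
        using r by (simp add: field_simps)
      then have "?\<sigma> x powr ((r - 1) / r) = w x powr (- 1 / r)"
        by (simp only: dual_weight_def powr_powr)
      then show ?case
        using elim by (simp add: powr_add[symmetric])
    qed
    then have "mass (\<lambda>_. 1) ?E \<le> mass w ?E powr (1 / r) * mass ?\<sigma> ?E powr ((r - 1) / r)"
      using r fw fE A_locD(4)[OF w]
      by (intro mass_Holder(2)) (auto simp: dual_weight_def field_simps)
    then have "v powr r \<le> (mass w ?E powr (1 / r) * mass ?\<sigma> ?E powr ((r - 1) / r)) powr r"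
      using r v by (intro powr_mono2) (auto simp: v_def mass_const_1_ball)
    also have "\<dots> = mass w ?E * mass ?\<sigma> ?E powr (r - 1)"
      using r by (simp add: powr_mult powr_powr)
    also have "\<dots> \<le> mass w ?E * mass ?\<sigma> ?B powr (r - 1)"
      using r by (intro mult_left_mono powr_mono2 mass_mono EB fB) auto
    finally have "mass w ?B * v powr r \<le> mass w ?B * (mass w ?E * mass ?\<sigma> ?B powr (r - 1))"
      by (rule mult_left_mono) simp
    also have "\<dots> = mass w ?E * (mass w ?B * mass ?\<sigma> ?B powr (r - 1))"
      by simp
    also have "\<dots> \<le> mass w ?E * (C * (2 ^ CARD('d) * v) powr r)"
      using bd[of "2 * \<rho>" z] \<rho> le1 v by (intro mult_left_mono) auto
    also have "\<dots> = K * mass w ?E * v powr r"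
      by (simp add: K_def powr_mult)
    finally have "mass w ?B \<le> K * mass w ?E"
      using v by simp
    moreover have "mass w (ball y \<rho>) \<le> mass w ?B"
      by (intro mass_mono EB fw) simp
    ultimately show ?thesis
      by simp
  qed
  moreover have "0 < K"
    using C by (simp add: K_def)
  ultimately show thesis
    using that by blast
qed

text \<open>The segment from \<open>z\<close> to \<open>y\<close> is divided into \<open>n\<close>
  steps of length at most \<open>\<rho>\<close>.\<close>

lemma doubling_chain:
  fixes m :: "'a::real_normed_vector \<Rightarrow> real"
  assumes K: "0 < K" and \<rho>: "0 < \<rho>" and step: "\<And>y z. dist y z \<le> \<rho> \<Longrightarrow> m y \<le> K * m z"
    and "dist y z \<le> real n * \<rho>"
  shows "m y \<le> K ^ n * m z"
  using assms(4)
proof (induction n arbitrary: y)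
  case 0
  then show ?case by simp
next
  case (Suc n)
  \<comment> \<open>The point at fraction n / (n + 1) of the segment is within \<open>n\<close>
    steps of \<open>z\<close> and one step of \<open>y\<close>.\<close>
  define y' where "y' = z + (real n / real (Suc n)) *\<^sub>R (y - z)"
  have "y' - z = (real n / real (Suc n)) *\<^sub>R (y - z)"
    by (simp add: y'_def)
  then have "dist y' z = real n / real (Suc n) * dist y z"
    by (simp add: dist_norm)
  also have "\<dots> \<le> real n / real (Suc n) * (real (Suc n) * \<rho>)"
    using Suc.prems by (intro mult_left_mono) auto
  finally have 1: "dist y' z \<le> real n * \<rho>"
    by simp
  have "y - y' = (1 - real n / real (Suc n)) *\<^sub>R (y - z)"
    by (simp add: y'_def algebra_simps)
  also have "1 - real n / real (Suc n) = 1 / real (Suc n)"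
    by (simp add: field_simps)
  finally have "dist y y' = dist y z / real (Suc n)"
    by (simp add: dist_norm)
  then have "dist y y' \<le> \<rho>"
    using Suc.prems by (simp add: pos_divide_le_eq mult.commute del: of_nat_Suc)
  then have "m y \<le> K * m y'"
    by (rule step)
  also have "\<dots> \<le> K * (K ^ n * m z)"
    using K Suc.IH[OF 1] by (intro mult_left_mono) auto
  finally show ?case
    by (simp add: mult.assoc)
qed

text \<open>Hoelder's inequality for a decomposition of 1 into powers of \<open>w\<close> and of the
  two dual weights gives |B|^k \<le> w(B) \<sigma>0(B)^\<gamma>0 \<sigma>1(B)^\<gamma>1. After
  multiplication by w0(B)^\<alpha> w1(B)^\<beta> the Muckenhoupt bounds apply, and |B|^k
  cancels.\<close>

lemma A_loc_ball_interpolation: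
  fixes w0 w1 :: "real ^ 'd \<Rightarrow> real"
  assumes w0: "w0 \<in> A_loc r0" "1 < r0" and w1: "w1 \<in> A_loc r1" "1 < r1"
    and \<alpha>\<beta>: "0 < \<alpha>" "0 < \<beta>" "\<alpha> + \<beta> = 1"
  defines "w \<equiv> \<lambda>x. w0 x powr \<alpha> * w1 x powr \<beta>"
  obtains C where "0 < C"
    and "\<And>x \<rho>. 0 < \<rho> \<Longrightarrow> emeasure lebesgue (ball x \<rho>) \<le> 1 \<Longrightarrow>
      mass w0 (ball x \<rho>) powr \<alpha> * mass w1 (ball x \<rho>) powr \<beta> \<le> C * mass w (ball x \<rho>)"
proof -
  obtain C0 where C0: "0 < C0"
    and fin0: "\<And>x \<rho>. 0 < \<rho> \<Longrightarrow> emeasure lebesgue (ball x \<rho>) \<le> 1 \<Longrightarrow> integral_over (ball x \<rho>) (dual_weight r0 w0) < \<infinity>"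
    and bd0: "\<And>x \<rho>. 0 < \<rho> \<Longrightarrow> emeasure lebesgue (ball x \<rho>) \<le> 1 \<Longrightarrow>
      mass w0 (ball x \<rho>) * mass (dual_weight r0 w0) (ball x \<rho>) powr (r0 - 1)
        \<le> C0 * measure lebesgue (ball x \<rho>) powr r0"
    by (rule A_loc_mass_bound[OF w0]) blast
  obtain C1 where C1: "0 < C1"
    and fin1: "\<And>x \<rho>. 0 < \<rho> \<Longrightarrow> emeasure lebesgue (ball x \<rho>) \<le> 1 \<Longrightarrow> integral_over (ball x \<rho>) (dual_weight r1 w1) < \<infinity>"
    and bd1: "\<And>x \<rho>. 0 < \<rho> \<Longrightarrow> emeasure lebesgue (ball x \<rho>) \<le> 1 \<Longrightarrow>
      mass w1 (ball x \<rho>) * mass (dual_weight r1 w1) (ball x \<rho>) powr (r1 - 1)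
        \<le> C1 * measure lebesgue (ball x \<rho>) powr r1"
    by (rule A_loc_mass_bound[OF w1]) blast
  note [measurable] = A_locD(3)[OF w0(1)] A_locD(3)[OF w1(1)]
  let ?\<sigma>0 = "dual_weight r0 w0" and ?\<sigma>1 = "dual_weight r1 w1"
  \<comment> \<open>The reciprocal of the exponent of \<open>w\<close> in the decomposition of 1,
    and also the power of |B| in the product of the two Muckenhoupt bounds raised to
    \<open>\<alpha>\<close> and \<open>\<beta>\<close>.\<close>
  define k where "k = \<alpha> * r0 + \<beta> * r1"
  define \<gamma>0 \<gamma>1 where "\<gamma>0 = \<alpha> * (r0 - 1)" and "\<gamma>1 = \<beta> * (r1 - 1)"
  have \<gamma>: "0 < \<gamma>0" "0 < \<gamma>1" "k = 1 + \<gamma>0 + \<gamma>1"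
    using w0(2) w1(2) \<alpha>\<beta> by (auto simp: \<gamma>0_def \<gamma>1_def k_def algebra_simps)
  \<comment> \<open>Merging the dual weights into one function reduces the inequality with three
    factors to two applications with two factors.\<close>
  define h where "h x = ?\<sigma>0 x powr (\<gamma>0 / (\<gamma>0 + \<gamma>1)) * ?\<sigma>1 x powr (\<gamma>1 / (\<gamma>0 + \<gamma>1))" for x
  have w_measurable [measurable]: "w \<in> borel_measurable lebesgue"
    unfolding w_def by measurable
  have h_measurable [measurable]: "h \<in> borel_measurable lebesgue"
    unfolding h_def[abs_def] by measurable
  have unit: "AE x in lebesgue. 1 \<le> w x powr (1 / k) * h x powr ((\<gamma>0 + \<gamma>1) / k)"
    using A_locD(2)[OF w0(1)] A_locD(2)[OF w1(1)]
  proof eventually_elim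
    case (elim x)
    \<comment> \<open>\<open>a * (r - 1)\<close> stands for \<open>\<gamma>0\<close> or
      \<open>\<gamma>1\<close>, and \<open>G\<close> for their sum.\<close>
    have cancel: "- 1 / (r - 1) * (a * (r - 1) / G) * (G / k) = - a / k" if "1 < r" "0 < G" for a r G
      using that by (simp add: divide_simps)
    have "- 1 / (r0 - 1) * (\<gamma>0 / (\<gamma>0 + \<gamma>1)) * ((\<gamma>0 + \<gamma>1) / k) = - \<alpha> / k"
      "- 1 / (r1 - 1) * (\<gamma>1 / (\<gamma>0 + \<gamma>1)) * ((\<gamma>0 + \<gamma>1) / k) = - \<beta> / k"
      using cancel[OF w0(2), of "\<gamma>0 + \<gamma>1" \<alpha>] cancel[OF w1(2), of "\<gamma>0 + \<gamma>1" \<beta>] \<gamma>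
      by (simp_all add: \<gamma>0_def \<gamma>1_def)
    then have "h x powr ((\<gamma>0 + \<gamma>1) / k) = w0 x powr (- \<alpha> / k) * w1 x powr (- \<beta> / k)"
      by (simp only: h_def dual_weight_def powr_mult powr_powr powr_ge_zero)
    moreover have "w x powr (1 / k) = w0 x powr (\<alpha> / k) * w1 x powr (\<beta> / k)"
      by (simp add: w_def powr_mult powr_powr)
    ultimately show ?case
      using elim by (simp add: powr_minus field_simps)
  qed
  define C where "C = C0 powr \<alpha> * C1 powr \<beta>"
  have "mass w0 (ball x \<rho>) powr \<alpha> * mass w1 (ball x \<rho>) powr \<beta> \<le> C * mass w (ball x \<rho>)"
    if \<rho>: "0 < \<rho>" "emeasure lebesgue (ball x \<rho>) \<le> 1" for x \<rho>
  proof -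
    let ?B = "ball x \<rho>"
    define v where "v = measure lebesgue ?B"
    have v: "0 < v"
      using \<rho> by (simp add: v_def)
    have fin_w: "integral_over ?B w < \<infinity>"
      by (rule mass_Holder(1)[OF A_locD(3)[OF w0(1)] A_locD(3)[OF w1(1)] _ A_locD(4)[OF w0(1)]
            A_locD(4)[OF w1(1)] weight_integral_finite[OF A_locD(1)[OF w0(1)]]
            weight_integral_finite[OF A_locD(1)[OF w1(1)]] \<alpha>\<beta>]) (simp_all add: w_def)
    have sum1: "\<gamma>0 / (\<gamma>0 + \<gamma>1) + \<gamma>1 / (\<gamma>0 + \<gamma>1) = 1" "1 / k + (\<gamma>0 + \<gamma>1) / k = 1"
      using \<gamma> by (simp_all add: add_divide_distrib[symmetric])
    have pos: "0 < \<gamma>0 / (\<gamma>0 + \<gamma>1)" "0 < \<gamma>1 / (\<gamma>0 + \<gamma>1)" "0 < 1 / k" "0 < (\<gamma>0 + \<gamma>1) / k"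
      using \<gamma> by simp_all
    have nonneg: "0 \<le> ?\<sigma>0 x" "0 \<le> ?\<sigma>1 x" "0 \<le> w x" "0 \<le> h x" for x
      by (simp_all add: dual_weight_def w_def h_def)
    have h: "integral_over ?B h < \<infinity>" "mass h ?B \<le> mass ?\<sigma>0 ?B powr (\<gamma>0 / (\<gamma>0 + \<gamma>1)) * mass ?\<sigma>1 ?B powr (\<gamma>1 / (\<gamma>0 + \<gamma>1))"
      by (rule mass_Holder[OF _ _ _ nonneg(1,2) fin0[OF \<rho>] fin1[OF \<rho>] pos(1,2) sum1(1)];
          simp add: h_def)+
    have "mass (\<lambda>_. 1) ?B \<le> mass w ?B powr (1 / k) * mass h ?B powr ((\<gamma>0 + \<gamma>1) / k)"
      by (rule mass_Holder(2)[OF _ _ _ nonneg(3,4) fin_w h(1) pos(3,4) sum1(2) unit]) simp_all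
    also have "\<dots> \<le> mass w ?B powr (1 / k)
        * (mass ?\<sigma>0 ?B powr (\<gamma>0 / (\<gamma>0 + \<gamma>1)) * mass ?\<sigma>1 ?B powr (\<gamma>1 / (\<gamma>0 + \<gamma>1))) powr ((\<gamma>0 + \<gamma>1) / k)"
      using \<gamma> h(2) by (intro mult_left_mono powr_mono2) auto
    also have "\<dots> = mass w ?B powr (1 / k) * mass ?\<sigma>0 ?B powr (\<gamma>0 / k) * mass ?\<sigma>1 ?B powr (\<gamma>1 / k)"
      using \<gamma> by (simp add: powr_mult powr_powr)
    finally have "v powr k \<le> (mass w ?B powr (1 / k) * mass ?\<sigma>0 ?B powr (\<gamma>0 / k) * mass ?\<sigma>1 ?B powr (\<gamma>1 / k)) powr k"
      using v \<gamma> by (intro powr_mono2) (auto simp: v_def mass_const_1_ball)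
    also have "\<dots> = mass w ?B * (mass ?\<sigma>0 ?B powr \<gamma>0 * mass ?\<sigma>1 ?B powr \<gamma>1)"
      using \<gamma> by (simp add: powr_mult powr_powr)
    \<comment> \<open>The new factors pair each dual mass with the mass of its own weight.\<close>
    finally have "(mass w0 ?B powr \<alpha> * mass w1 ?B powr \<beta>) * v powr k
      \<le> (mass w0 ?B powr \<alpha> * mass w1 ?B powr \<beta>) * (mass w ?B * (mass ?\<sigma>0 ?B powr \<gamma>0 * mass ?\<sigma>1 ?B powr \<gamma>1))"
      by (rule mult_left_mono) simp
    also have "\<dots> = mass w ?B * ((mass w0 ?B * mass ?\<sigma>0 ?B powr (r0 - 1)) powr \<alpha>
        * (mass w1 ?B * mass ?\<sigma>1 ?B powr (r1 - 1)) powr \<beta>)"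
      by (simp add: powr_mult powr_powr \<gamma>0_def \<gamma>1_def mult_ac)
    also have "\<dots> \<le> mass w ?B * ((C0 * v powr r0) powr \<alpha> * (C1 * v powr r1) powr \<beta>)"
      using powr_mono2[OF _ _ bd0[OF \<rho>], of \<alpha>] powr_mono2[OF _ _ bd1[OF \<rho>], of \<beta>] \<alpha>\<beta> unfolding v_def
      by (intro mult_left_mono mult_mono) simp_all
    also have "\<dots> = C * mass w ?B * v powr k"
      using v by (simp add: C_def k_def powr_mult powr_powr powr_add mult_ac)
    finally show ?thesis
      using v by simp
  qed
  moreover have "0 < C"
    using C0 C1 by (simp add: C_def)
  ultimately show thesis
    using that by blast
qed

section \<open>Local Muckenhoupt weights on dyadic cubes\<close>

text \<open>The cubes of level \<open>j\<close> are the fibres of this map, so a sum over them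
  becomes a composition with it.\<close>

definition cube_index :: "nat \<Rightarrow> real ^ 'd \<Rightarrow> int ^ 'd" where
  "cube_index j x = (\<chi> l. \<lfloor>2 ^ j * x $ l\<rfloor>)"

lemma mem_dyadic_cube_iff: "x \<in> dyadic_cube j k \<longleftrightarrow> cube_index j x = k"
proof -
  have "2 powr (- real j) * real_of_int (k $ l) \<le> x $ l \<and> x $ l < 2 powr (- real j) * (real_of_int (k $ l) + 1)
    \<longleftrightarrow> \<lfloor>2 ^ j * x $ l\<rfloor> = k $ l" for l
    unfolding floor_eq_iff by (simp add: powr_minus powr_realpow field_simps)
  then show ?thesis
    by (simp add: dyadic_cube_def cube_index_def vec_eq_iff)
qed

lemma dyadic_cube_measurable [measurable]: "dyadic_cube j k \<in> sets lebesgue"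
proof -
  have "dyadic_cube j k \<in> sets borel"
    unfolding dyadic_cube_def by measurable
  then show ?thesis
    by simp
qed

lemma cube_index_measurable [measurable]:
  "(cube_index j :: real ^ 'd \<Rightarrow> int ^ 'd) \<in> lebesgue \<rightarrow>\<^sub>M count_space UNIV"
proof -
  have "cube_index j -` {k} = dyadic_cube j k" for k :: "int ^ 'd"
    by (auto simp: mem_dyadic_cube_iff)
  then show ?thesis
    by (simp add: measurable_count_space_eq2_countable dyadic_cube_measurable)
qed

definition dyadic_center :: "nat \<Rightarrow> int ^ 'd \<Rightarrow> real ^ 'd" where
  "dyadic_center j k = (\<chi> l. (of_int (k $ l) + 1 / 2) / 2 ^ j)"

text \<open>A coordinate is at most the norm, and half the side of the cube is
  \<open>1 / 2 / 2 ^ j\<close>.\<close>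

lemma ball_subset_dyadic_cube:
  assumes "\<epsilon> \<le> 1 / 2"
  shows "ball (dyadic_center j k) (\<epsilon> / 2 ^ j) \<subseteq> dyadic_cube j k"
proof
  fix x assume x: "x \<in> ball (dyadic_center j k) (\<epsilon> / 2 ^ j)"
  have "2 powr (- real j) * of_int (k $ l) \<le> x $ l \<and> x $ l < 2 powr (- real j) * (of_int (k $ l) + 1)" for l
  proof -
    have "\<bar>(x - dyadic_center j k) $ l\<bar> \<le> norm (x - dyadic_center j k)"
      by (rule component_le_norm_cart)
    also have "\<dots> < \<epsilon> / 2 ^ j"
      using x by (simp add: dist_norm norm_minus_commute)
    also have "\<dots> \<le> 1 / 2 / 2 ^ j"
      using assms by (intro divide_right_mono) auto
    finally have "\<bar>x $ l - (of_int (k $ l) + 1 / 2) / 2 ^ j\<bar> < 1 / 2 / 2 ^ j"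
      by (simp add: dyadic_center_def)
    then have "\<bar>2 ^ j * x $ l - (of_int (k $ l) + 1 / 2)\<bar> < 1 / 2"
      by (simp add: abs_less_iff field_simps)
    then show ?thesis
      by (simp add: powr_minus powr_realpow abs_less_iff field_simps)
  qed
  then show "x \<in> dyadic_cube j k"
    by (simp add: dyadic_cube_def)
qed

lemma emeasure_dyadic_cube_pos: "0 < emeasure lebesgue (dyadic_cube j k)"
proof -
  have "0 < emeasure lebesgue (ball (dyadic_center j k) (1 / 2 / 2 ^ j))"
    by (simp add: emeasure_lebesgue_ball)
  also have "\<dots> \<le> emeasure lebesgue (dyadic_cube j k)"
    by (intro emeasure_mono ball_subset_dyadic_cube) auto
  finally show ?thesis .
qed

text \<open>Translation and scaling carry every cube into one compact reference cube, so a single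
  finite cover of that cube provides \<open>F\<close> and \<open>n\<close> independent of
  \<open>j\<close> and \<open>k\<close>.\<close>

lemma dyadic_cube_cover:
  fixes \<epsilon> :: real
  assumes "0 < \<epsilon>"
  obtains F :: "(real ^ 'd) set" and n where "finite F"
    and "\<And>j k. dyadic_cube j k \<subseteq> (\<Union>f\<in>F. ball (dyadic_center j k + f /\<^sub>R 2 ^ j) (\<epsilon> / 2 ^ j))"
    and "\<And>j k f. f \<in> F \<Longrightarrow> dist (dyadic_center j k + f /\<^sub>R 2 ^ j) (dyadic_center j k) \<le> real n * (\<epsilon> / 2 ^ j)"
proof -
  define U :: "(real ^ 'd) set" where "U = cbox (\<chi> l. - 1 / 2) (\<chi> l. 1 / 2)"
  have "U \<subseteq> (\<Union>f\<in>U. ball f \<epsilon>)"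
    using assms by auto
  then obtain F where F: "F \<subseteq> U" "finite F" "U \<subseteq> (\<Union>f\<in>F. ball f \<epsilon>)"
    by (rule compactE_image[rotated 2]) (auto simp: U_def)
  have "bounded U"
    by (simp add: U_def)
  then obtain D where D: "\<And>x. x \<in> U \<Longrightarrow> norm x \<le> D"
    unfolding bounded_iff by blast
  \<comment> \<open>\<open>n\<close> radii \<open>\<epsilon>\<close> reach from the origin to every
    point of \<open>U\<close>; this becomes the number of doubling steps.\<close>
  obtain n where n: "D / \<epsilon> \<le> real n"
    using real_arch_simple by blast
  show thesis
  proof (rule that[OF F(2), of n])
    fix j :: nat and k :: "int ^ 'd"
    show "dyadic_cube j k \<subseteq> (\<Union>f\<in>F. ball (dyadic_center j k + f /\<^sub>R 2 ^ j) (\<epsilon> / 2 ^ j))"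
    proof
      fix x assume x: "x \<in> dyadic_cube j k"
      \<comment> \<open>The point \<open>x\<close> in the coordinates of the reference cube
        \<open>U\<close>.\<close>
      define y where "y = 2 ^ j *\<^sub>R (x - dyadic_center j k)"
      have "- 1 / 2 \<le> y $ l \<and> y $ l \<le> 1 / 2" for l
      proof -
        have "2 powr (- real j) * of_int (k $ l) \<le> x $ l" "x $ l < 2 powr (- real j) * (of_int (k $ l) + 1)"
          using x by (auto simp: dyadic_cube_def)
        then have "of_int (k $ l) \<le> 2 ^ j * x $ l" "2 ^ j * x $ l < of_int (k $ l) + 1"
          by (simp_all add: powr_minus powr_realpow field_simps)
        then show ?thesis
          by (simp add: y_def dyadic_center_def right_diff_distrib)
      qed
      then have "y \<in> U"
        by (simp add: U_def mem_box_cart)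
      then obtain f where f: "f \<in> F" "dist f y < \<epsilon>"
        using F(3) by auto
      have "x = dyadic_center j k + y /\<^sub>R 2 ^ j"
        by (simp add: y_def)
      then have "dist (dyadic_center j k + f /\<^sub>R 2 ^ j) x = dist f y / 2 ^ j"
        by (simp add: dist_norm scaleR_diff_right[symmetric] divide_inverse mult.commute)
      also have "\<dots> < \<epsilon> / 2 ^ j"
        using f(2) by (intro divide_strict_right_mono) auto
      finally show "x \<in> (\<Union>f\<in>F. ball (dyadic_center j k + f /\<^sub>R 2 ^ j) (\<epsilon> / 2 ^ j))"
        using f(1) by auto
    qed
    fix f assume "f \<in> F"
    then have "norm f \<le> real n * \<epsilon>"
      using D[of f] F(1) n assms by (auto simp: field_simps)
    then show "dist (dyadic_center j k + f /\<^sub>R 2 ^ j) (dyadic_center j k) \<le> real n * (\<epsilon> / 2 ^ j)"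
      by (simp add: dist_norm field_simps)
  qed
qed

lemma bounded_dyadic_cube:
  fixes k :: "int ^ 'd"
  shows "bounded (dyadic_cube j k)"
proof -
  obtain F :: "(real ^ 'd) set" and n :: nat where "finite F"
    "dyadic_cube j k \<subseteq> (\<Union>f\<in>F. ball (dyadic_center j k + f /\<^sub>R 2 ^ j) (1 / 2 ^ j))"
    by (rule dyadic_cube_cover[OF zero_less_one, where 'd='d]) blast
  then show ?thesis
    by (meson bounded_UN bounded_ball bounded_subset)
qed

lemma mass_Un_le:
  assumes [measurable]: "w \<in> borel_measurable lebesgue" "\<And>i. i \<in> I \<Longrightarrow> A i \<in> sets lebesgue"
    and I: "finite I" and S: "S \<subseteq> (\<Union>i\<in>I. A i)"
    and fin: "\<And>i. i \<in> I \<Longrightarrow> integral_over (A i) w < \<infinity>"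
  shows "mass w S \<le> (\<Sum>i\<in>I. mass w (A i))"
proof -
  have "integral_over S w \<le> (\<integral>\<^sup>+x. (\<Sum>i\<in>I. ennreal (w x) * indicator (A i) x) \<partial>lebesgue)"
  proof (rule nn_integral_mono)
    fix x
    show "ennreal (w x) * indicator S x \<le> (\<Sum>i\<in>I. ennreal (w x) * indicator (A i) x)"
    proof (cases "x \<in> S")
      case True
      then obtain i where i: "i \<in> I" "x \<in> A i"
        using S by auto
      then have "ennreal (w x) * indicator S x = ennreal (w x) * indicator (A i) x"
        using True by simp
      also have "\<dots> \<le> (\<Sum>i\<in>I. ennreal (w x) * indicator (A i) x)"
        using i I by (intro member_le_sum) auto
      finally show ?thesis .
    qed simp
  qed
  also have "\<dots> = (\<Sum>i\<in>I. integral_over (A i) w)"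
    by (rule nn_integral_sum) simp
  also have "\<dots> = ennreal (\<Sum>i\<in>I. mass w (A i))"
    using fin by (simp add: ennreal_mass[symmetric])
  finally have "integral_over S w \<le> ennreal (\<Sum>i\<in>I. mass w (A i))" .
  from enn2real_mono[OF this] show ?thesis
    by (simp add: mass_def[of w S] sum_nonneg)
qed

text \<open>The cube is covered by a fixed number of balls of radius
  \<open>\<epsilon> / 2 ^ j\<close>, and \<open>n\<close> doubling steps compare each of them with
  the concentric ball.\<close>

lemma A_loc_dyadic_cube:
  fixes w :: "real ^ 'd \<Rightarrow> real"
  assumes w: "w \<in> A_loc r" and r: "1 < r"
    and \<epsilon>: "0 < \<epsilon>" "\<And>z :: real ^ 'd. emeasure lebesgue (ball z (2 * \<epsilon>)) \<le> 1"
  obtains K where "0 < K"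
    and "\<And>j k. mass w (dyadic_cube j k) \<le> K * mass w (ball (dyadic_center j k) (\<epsilon> / 2 ^ j))"
proof -
  obtain K where K: "0 < K"
    and dbl: "\<And>y z \<rho>. 0 < \<rho> \<Longrightarrow> emeasure lebesgue (ball z (2 * \<rho>)) \<le> 1 \<Longrightarrow> dist y z \<le> \<rho> \<Longrightarrow>
      mass w (ball y \<rho>) \<le> K * mass w (ball z \<rho>)"
    by (rule A_loc_doubling[OF w r]) blast
  obtain F :: "(real ^ 'd) set" and n where F: "finite F"
    "\<And>j k. dyadic_cube j k \<subseteq> (\<Union>f\<in>F. ball (dyadic_center j k + f /\<^sub>R 2 ^ j) (\<epsilon> / 2 ^ j))"
    "\<And>j k f. f \<in> F \<Longrightarrow> dist (dyadic_center j k + f /\<^sub>R 2 ^ j) (dyadic_center j k) \<le> real n * (\<epsilon> / 2 ^ j)"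
    by (rule dyadic_cube_cover[OF \<epsilon>(1), where 'd='d]) blast
  note [measurable] = A_locD(3)[OF w]
  \<comment> \<open>Adding 1 keeps \<open>K'\<close> positive even for empty
    \<open>F\<close>.\<close>
  define K' where "K' = (real (card F) + 1) * K ^ n"
  have "mass w (dyadic_cube j k) \<le> K' * mass w (ball (dyadic_center j k) (\<epsilon> / 2 ^ j))" for j k
  proof -
    define \<rho> where "\<rho> = \<epsilon> / 2 ^ j"
    have \<rho>: "0 < \<rho>" "\<rho> \<le> \<epsilon>"
      using \<epsilon> by (auto simp: \<rho>_def field_simps)
    have small: "emeasure lebesgue (ball z (2 * \<rho>)) \<le> 1" for z :: "real ^ 'd"
    proof -
      have "emeasure lebesgue (ball z (2 * \<rho>)) \<le> emeasure lebesgue (ball z (2 * \<epsilon>))"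
        using \<rho> by (intro emeasure_mono subset_ball) auto
      also note \<epsilon>(2)
      finally show ?thesis .
    qed
    let ?c = "dyadic_center j k"
    let ?m = "\<lambda>y. mass w (ball y \<rho>)"
    have chain: "?m (?c + f /\<^sub>R 2 ^ j) \<le> K ^ n * ?m ?c" if "f \<in> F" for f
      by (rule doubling_chain[where m = ?m, OF K \<rho>(1) dbl[OF \<rho>(1) small]
            F(3)[OF that, of j k, folded \<rho>_def]])
    have "mass w (dyadic_cube j k) \<le> (\<Sum>f\<in>F. ?m (?c + f /\<^sub>R 2 ^ j))"
      using F unfolding \<rho>_def
      by (intro mass_Un_le weight_integral_finite A_locD[OF w]) auto
    also have "\<dots> \<le> real (card F) * (K ^ n * ?m ?c)"
      using sum_bounded_above[of F "\<lambda>f. ?m (?c + f /\<^sub>R 2 ^ j)", OF chain] by simp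
    also have "\<dots> \<le> K' * ?m ?c"
      using K by (simp add: K'_def algebra_simps)
    finally show ?thesis
      by (simp add: \<rho>_def)
  qed
  moreover have "0 < K'"
    using K by (simp add: K'_def add_nonneg_pos)
  ultimately show thesis
    using that by blast
qed

text \<open>The masses of \<open>w0\<close> and \<open>w1\<close> pass from the cube to a small
  concentric ball by doubling, the interpolation is done on that ball, and the mass of
  \<open>w\<close> returns to the cube by monotonicity.\<close>

lemma A_loc_dyadic_interpolation:
  fixes w0 w1 :: "real ^ 'd \<Rightarrow> real"
  assumes w0: "w0 \<in> A_loc r0" "1 < r0" and w1: "w1 \<in> A_loc r1" "1 < r1"
    and \<alpha>\<beta>: "0 < \<alpha>" "0 < \<beta>" "\<alpha> + \<beta> = 1"
  defines "w \<equiv> \<lambda>x. w0 x powr \<alpha> * w1 x powr \<beta>"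
  obtains C where "0 < C"
    and "\<And>j k. mass w0 (dyadic_cube j k) powr \<alpha> * mass w1 (dyadic_cube j k) powr \<beta>
      \<le> C * mass w (dyadic_cube j k)"
proof -
  define V where "V = unit_ball_vol (real CARD('d))"
  \<comment> \<open>Then \<open>2 * \<epsilon> \<le> 1\<close> and
    \<open>V * (2 * \<epsilon>) \<le> 1\<close>, so balls of radius \<open>2 * \<epsilon>\<close>
    have volume at most 1; moreover \<open>\<epsilon> \<le> 1 / 2\<close> keeps the concentric ball
    inside the cube.\<close>
  define \<epsilon> where "\<epsilon> = min (1 / 2) (1 / V) / 2"
  have V: "0 < V"
    by (simp add: V_def)
  have \<epsilon>: "0 < \<epsilon>" "\<epsilon> \<le> 1 / 2"
    using V by (auto simp: \<epsilon>_def)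
  have small: "emeasure lebesgue (ball z (2 * \<epsilon>)) \<le> 1" for z :: "real ^ 'd"
  proof -
    have "V * (2 * \<epsilon>) ^ CARD('d) \<le> V * (2 * \<epsilon>) ^ 1"
      using V \<epsilon> by (intro mult_left_mono power_decreasing) (auto simp: Suc_le_eq)
    also have "\<dots> \<le> 1"
      using V by (simp add: \<epsilon>_def min_def field_simps)
    finally show ?thesis
      using \<epsilon> measure_lebesgue_ball[of "2 * \<epsilon>" z] unfolding emeasure_lebesgue_ball by (simp add: V_def)
  qed
  obtain K0 where K0: "0 < K0"
    "\<And>j k. mass w0 (dyadic_cube j k) \<le> K0 * mass w0 (ball (dyadic_center j k) (\<epsilon> / 2 ^ j))"
    by (rule A_loc_dyadic_cube[OF w0 \<epsilon>(1) small]) blast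
  obtain K1 where K1: "0 < K1"
    "\<And>j k. mass w1 (dyadic_cube j k) \<le> K1 * mass w1 (ball (dyadic_center j k) (\<epsilon> / 2 ^ j))"
    by (rule A_loc_dyadic_cube[OF w1 \<epsilon>(1) small]) blast
  obtain C where C: "0 < C"
    "\<And>x \<rho>. 0 < \<rho> \<Longrightarrow> emeasure lebesgue (ball x \<rho>) \<le> 1 \<Longrightarrow>
      mass w0 (ball x \<rho>) powr \<alpha> * mass w1 (ball x \<rho>) powr \<beta> \<le> C * mass w (ball x \<rho>)"
    unfolding w_def by (rule A_loc_ball_interpolation[OF w0 w1 \<alpha>\<beta>]) blast
  define C' where "C' = K0 powr \<alpha> * K1 powr \<beta> * C"
  have "mass w0 (dyadic_cube j k) powr \<alpha> * mass w1 (dyadic_cube j k) powr \<beta> \<le> C' * mass w (dyadic_cube j k)" for j k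
  proof -
    let ?B = "ball (dyadic_center j k) (\<epsilon> / 2 ^ j)"
    have "\<epsilon> / 2 ^ j \<le> \<epsilon> / 1"
      using \<epsilon> by (intro divide_left_mono) auto
    then have "emeasure lebesgue ?B \<le> emeasure lebesgue (ball (dyadic_center j k) (2 * \<epsilon>))"
      using \<epsilon> by (intro emeasure_mono subset_ball) auto
    also note small
    finally have B: "emeasure lebesgue ?B \<le> 1" .
    have fin: "integral_over (dyadic_cube j k) w < \<infinity>"
      unfolding w_def
      by (rule mass_Holder(1)[OF A_locD(3)[OF w0(1)] A_locD(3)[OF w1(1)] _ A_locD(4)[OF w0(1)]
            A_locD(4)[OF w1(1)] weight_integral_finite[OF A_locD(1)[OF w0(1)]]
            weight_integral_finite[OF A_locD(1)[OF w1(1)]] \<alpha>\<beta>]) (simp_all add: bounded_dyadic_cube)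
    have "mass w0 (dyadic_cube j k) powr \<alpha> * mass w1 (dyadic_cube j k) powr \<beta>
      \<le> (K0 * mass w0 ?B) powr \<alpha> * (K1 * mass w1 ?B) powr \<beta>"
      using K0 K1 \<alpha>\<beta> by (intro mult_mono powr_mono2) auto
    also have "\<dots> = K0 powr \<alpha> * K1 powr \<beta> * (mass w0 ?B powr \<alpha> * mass w1 ?B powr \<beta>)"
      using K0 K1 by (simp add: powr_mult)
    also have "\<dots> \<le> K0 powr \<alpha> * K1 powr \<beta> * (C * mass w ?B)"
      using C(2)[OF _ B] \<epsilon> by (intro mult_left_mono) auto
    also have "\<dots> \<le> K0 powr \<alpha> * K1 powr \<beta> * (C * mass w (dyadic_cube j k))"
      using C(1) \<epsilon> fin by (intro mult_left_mono mass_mono ball_subset_dyadic_cube) auto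
    finally show ?thesis
      by (simp add: C'_def mult.assoc)
  qed
  moreover have "0 < C'"
    using C K0 K1 by (simp add: C'_def)
  ultimately show thesis
    using that by blast
qed

section \<open>Sequence spaces of Besov type\<close>

lemma infsum_dyadic_cubes:
  fixes c :: "int ^ 'd \<Rightarrow> real"
  shows "(\<Sum>\<^sub>\<infinity>k. c k * indicator (dyadic_cube j k) x) = c (cube_index j x)"
proof -
  have "(\<Sum>\<^sub>\<infinity>k. c k * indicator (dyadic_cube j k) x)
    = (\<Sum>\<^sub>\<infinity>k\<in>{cube_index j x}. c k * indicator (dyadic_cube j k) x)"
    by (rule infsum_cong_neutral) (auto simp: mem_dyadic_cube_iff)
  then show ?thesis
    by (simp add: mem_dyadic_cube_iff)
qed

text \<open>Every cube has positive measure, so none of the values is lost in the essential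
  supremum.\<close>

lemma esssup_cube_index:
  fixes c :: "int ^ 'd \<Rightarrow> ennreal"
  shows "esssup lebesgue (\<lambda>x. c (cube_index j x)) = (SUP k. c k)"
proof (rule antisym)
  show "esssup lebesgue (\<lambda>x. c (cube_index j x)) \<le> (SUP k. c k)"
    by (rule esssup_I) (auto intro: SUP_upper)
  show "(SUP k. c k) \<le> esssup lebesgue (\<lambda>x. c (cube_index j x))"
  proof (rule SUP_least, rule ccontr)
    fix k assume less: "\<not> c k \<le> esssup lebesgue (\<lambda>x. c (cube_index j x))"
    have "AE x in lebesgue. x \<notin> dyadic_cube j k"
      using esssup_AE[where M = lebesgue and f = "\<lambda>x. c (cube_index j x)"]
      by eventually_elim (use less in \<open>auto simp: mem_dyadic_cube_iff\<close>)
    then have "emeasure lebesgue (dyadic_cube j k) = 0"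
      by (subst (asm) AE_iff_measurable[of "dyadic_cube j k"]) auto
    then show False
      using emeasure_dyadic_cube_pos[of j k] by simp
  qed
qed

text \<open>The integrand is a sum over \<open>k\<close> with at most one nonzero term; sum and
  integral are interchanged because the index set is countable.\<close>

lemma nn_integral_cube_index:
  fixes c :: "int ^ 'd \<Rightarrow> real"
  assumes [measurable]: "w \<in> borel_measurable lebesgue"
    and fin: "\<And>k. integral_over (dyadic_cube j k) w < \<infinity>" and c: "\<And>k. 0 \<le> c k"
  shows "(\<integral>\<^sup>+x. ennreal (c (cube_index j x) * w x) \<partial>lebesgue)
    = (\<integral>\<^sup>+k. ennreal (c k * mass w (dyadic_cube j k)) \<partial>count_space UNIV)"
proof -
  have "ennreal (c (cube_index j x) * w x)
    = (\<integral>\<^sup>+k. ennreal (c k) * (ennreal (w x) * indicator (dyadic_cube j k) x) \<partial>count_space UNIV)" for x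
    using c by (subst nn_integral_count_space'[of "{cube_index j x}"])
      (auto simp: mem_dyadic_cube_iff ennreal_mult')
  then have "(\<integral>\<^sup>+x. ennreal (c (cube_index j x) * w x) \<partial>lebesgue)
    = (\<integral>\<^sup>+x. \<integral>\<^sup>+k. ennreal (c k) * (ennreal (w x) * indicator (dyadic_cube j k) x) \<partial>count_space UNIV \<partial>lebesgue)"
    by simp
  also have "\<dots> = (\<integral>\<^sup>+k. \<integral>\<^sup>+x. ennreal (c k) * (ennreal (w x) * indicator (dyadic_cube j k) x) \<partial>lebesgue \<partial>count_space UNIV)"
    by (rule nn_integral_count_space_nn_integral) auto
  also have "\<dots> = (\<integral>\<^sup>+k. ennreal (c k * mass w (dyadic_cube j k)) \<partial>count_space UNIV)"
    using c by (simp add: nn_integral_cmult ennreal_mult' ennreal_mass[OF fin])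
  finally show ?thesis .
qed

definition cube_weight :: "real \<Rightarrow> ennreal \<Rightarrow> (real ^ 'd \<Rightarrow> real) \<Rightarrow> nat \<times> (int ^ 'd) \<Rightarrow> real" where
  "cube_weight s p w = (\<lambda>(j, k). 2 powr (s * real j) * mass w (dyadic_cube j k) powr (1 / enn2real p))"

text \<open>The cases \<open>p = \<infinity>\<close> and \<open>p < \<infinity>\<close> are covered by the same \<^const>\<open>cube_weight\<close>
  because \<open>1 / enn2real \<infinity> = 0\<close>; for \<open>p = \<infinity>\<close> this needs every cube to have positive mass,
  as \<open>0 powr 0 = 0\<close>.\<close>

lemma b_space_eq_mixed_space:
  fixes w :: "real ^ 'd \<Rightarrow> real"
  assumes p: "0 < p" and w [measurable]: "w \<in> borel_measurable lebesgue"
    and fin: "\<And>j k. integral_over (dyadic_cube j k) w < \<infinity>"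
    and pos: "\<And>j k. 0 < mass w (dyadic_cube j k)"
  shows "b_space s p q w = mixed_space p q (cube_weight s p w)"
proof -
  have "Lp_qnorm p w (\<lambda>x. \<Sum>\<^sub>\<infinity>k. 2 powr (s * real j) * cmod (u (j, k)) * indicator (dyadic_cube j k) x)
    = seq_qnorm p (\<lambda>k. ennreal (cube_weight s p w (j, k) * cmod (u (j, k))))" for u j
  proof (cases "p = top")
    case True
    have "mass w (dyadic_cube j k) \<noteq> 0" for k
      using pos[of j k] by simp
    then show ?thesis
      using True esssup_cube_index[of "\<lambda>k. ennreal (2 powr (s * real j) * cmod (u (j, k)))" j]
      by (simp add: Lp_qnorm_def seq_qnorm_def infsum_dyadic_cubes cube_weight_def)
  next
    case False
    define r where "r = enn2real p"
    have r: "0 < r"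
      using enn2real_pos[OF p False] by (simp add: r_def)
    \<comment> \<open>The mass of the cube enters the sequence entry as its \<open>r\<close>-th
      root.\<close>
    have "(2 powr (s * real j) * cmod (u (j, k))) powr r * mass w (dyadic_cube j k)
      = (2 powr (s * real j) * mass w (dyadic_cube j k) powr (1 / r) * cmod (u (j, k))) powr r" for k
      using r by (simp add: powr_mult powr_powr)
    then show ?thesis
      using False nn_integral_cube_index[OF w fin, of "\<lambda>k. (2 powr (s * real j) * cmod (u (j, k))) powr r" j]
      by (simp add: Lp_qnorm_def seq_qnorm_def infsum_dyadic_cubes cube_weight_def r_def[symmetric] ennpowr_ennreal)
  qed
  then have "b_qnorm s p q w u = mixed_qnorm p q (cube_weight s p w) u" for u
    by (simp add: b_qnorm_def mixed_qnorm_def lq_qnorm_eq_seq_qnorm)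
  then show ?thesis
    by (simp add: b_space_def mixed_space_def fun_eq_iff)
qed

theorem corollary18:
  fixes \<Theta> s0 s1 s :: real
    and p0 p1 p q0 q1 q :: ennreal
    and w0 w1 w :: "real ^ 'd \<Rightarrow> real"
  assumes "0 < \<Theta>" and "\<Theta> < 1"
    and "0 < p0" and "0 < p1" and "0 < q0" and "0 < q1"
    and "1 / p = ennreal (1 - \<Theta>) / p0 + ennreal \<Theta> / p1"
    and "1 / q = ennreal (1 - \<Theta>) / q0 + ennreal \<Theta> / q1"
    and "s = (1 - \<Theta>) * s0 + \<Theta> * s1"
    and "w0 \<in> A_loc_infinity" and "w1 \<in> A_loc_infinity"
    and "w = interpolated_weight \<Theta> p p0 p1 w0 w1"
  shows "equal_equivalent_qnorms
           (calderon_product (count_space UNIV) \<Theta> (b_space s0 p0 q0 w0) (b_space s1 p1 q1 w1))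
           (b_space s p q w)"
proof -
  obtain a0 where w0: "w0 \<in> A_loc a0" "1 < a0"
    using assms(10) by (auto simp: A_loc_infinity_def)
  obtain a1 where w1: "w1 \<in> A_loc a1" "1 < a1"
    using assms(11) by (auto simp: A_loc_infinity_def)
  note [measurable] = A_locD(3)[OF w0(1)] A_locD(3)[OF w1(1)]
  note rel = exponent_relation[OF assms(1-4) assms(7)]
  let ?Q = dyadic_cube
  have fin0: "integral_over (?Q j k) w0 < \<infinity>" for j and k :: "int ^ 'd"
    by (intro weight_integral_finite A_locD(1)[OF w0(1)] bounded_dyadic_cube)
  have fin1: "integral_over (?Q j k) w1 < \<infinity>" for j and k :: "int ^ 'd"
    by (intro weight_integral_finite A_locD(1)[OF w1(1)] bounded_dyadic_cube)
  have pos0: "0 < mass w0 (?Q j k)" for j and k :: "int ^ 'd"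
    using emeasure_dyadic_cube_pos fin0 by (intro mass_pos A_locD[OF w0(1)]) auto
  have pos1: "0 < mass w1 (?Q j k)" for j and k :: "int ^ 'd"
    using emeasure_dyadic_cube_pos fin1 by (intro mass_pos A_locD[OF w1(1)]) auto

  define r r0 r1 where "r = enn2real p" and "r0 = enn2real p0" and "r1 = enn2real p1"
  have r_rel: "1 / r = (1 - \<Theta>) / r0 + \<Theta> / r1"
    using rel(3) by (simp add: r_def r0_def r1_def)
  \<comment> \<open>One statement for finite and infinite exponents: an infinite exponent becomes 0
    under \<open>enn2real\<close>, division by it gives 0, and the power 0 of a positive mass is
    1.\<close>
  have "w \<in> borel_measurable lebesgue \<and> (\<forall>j k. integral_over (?Q j k) w < \<infinity> \<and> 0 < mass w (?Q j k)) \<and>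
    (\<exists>C>0. \<forall>j k. mass w (?Q j k) powr (1 / r)
        \<le> C * (mass w0 (?Q j k) powr ((1 - \<Theta>) / r0) * mass w1 (?Q j k) powr (\<Theta> / r1)) \<and>
      mass w0 (?Q j k) powr ((1 - \<Theta>) / r0) * mass w1 (?Q j k) powr (\<Theta> / r1)
        \<le> C * mass w (?Q j k) powr (1 / r))"
  proof -
    consider (fin) "p0 \<noteq> top" "p1 \<noteq> top" | (inf0) "p0 = top" "p1 \<noteq> top"
      | (inf1) "p0 \<noteq> top" "p1 = top" | (inf) "p0 = top" "p1 = top"
      by blast
    then show ?thesis
    proof cases
      case inf
      then have w: "w = (\<lambda>_. 1)" "r = 0" "r0 = 0" "r1 = 0"
        using assms(12) rel(2) by (auto simp: interpolated_weight_def r_def r0_def r1_def)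
      have fin: "integral_over (?Q j k) w < \<infinity>" for j and k :: "int ^ 'd"
        using fmeasurableD2[OF bounded_set_imp_lmeasurable[OF bounded_dyadic_cube[of j k] dyadic_cube_measurable]] w
        by (simp add: less_top)
      have pos: "0 < mass w (?Q j k)" for j and k :: "int ^ 'd"
        using emeasure_dyadic_cube_pos fin by (intro mass_pos) (auto simp: w)
      \<comment> \<open>Every power of a mass is 1 here, so \<open>C = 1\<close> works.\<close>
      show ?thesis
        using fin pos pos0 pos1 by (auto simp: w less_imp_neq[symmetric] intro!: exI[of _ 1])
    next
      case inf0
      \<comment> \<open>The infinite exponent removes \<open>w0\<close> from the product, and both
        inequalities become equalities with \<open>C = 1\<close>.\<close>
      then have "w = w1" "\<Theta> / r1 = 1 / r" "r0 = 0"
        using assms(12) r_rel by (auto simp: interpolated_weight_def r0_def)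
      then show ?thesis
        using fin1 pos1 pos0 by (auto simp: less_imp_neq[symmetric] intro!: exI[of _ 1])
    next
      case inf1
      then have "w = w0" "(1 - \<Theta>) / r0 = 1 / r" "r1 = 0"
        using assms(12) r_rel by (auto simp: interpolated_weight_def r1_def)
      then show ?thesis
        using fin0 pos0 pos1 by (auto simp: less_imp_neq[symmetric] intro!: exI[of _ 1])
    next
      case fin
      have r: "0 < r" "0 < r0" "0 < r1"
        using fin enn2real_pos assms(3,4) rel by (auto simp: r_def r0_def r1_def)
      define \<alpha> \<beta> where "\<alpha> = (1 - \<Theta>) * r / r0" and "\<beta> = \<Theta> * r / r1"
      have \<alpha>\<beta>: "0 < \<alpha>" "0 < \<beta>" "\<alpha> + \<beta> = 1"
        using assms(1,2) r r_rel by (auto simp: \<alpha>_def \<beta>_def field_simps)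
      have w_eq: "w = (\<lambda>x. w0 x powr \<alpha> * w1 x powr \<beta>)"
        using fin assms(12) by (simp add: interpolated_weight_def \<alpha>_def \<beta>_def r_def r0_def r1_def)
      have w_measurable: "w \<in> borel_measurable lebesgue"
        unfolding w_eq by measurable
      have up: "integral_over (?Q j k) w < \<infinity>"
        "mass w (?Q j k) \<le> mass w0 (?Q j k) powr \<alpha> * mass w1 (?Q j k) powr \<beta>" for j and k :: "int ^ 'd"
        by (rule mass_Holder[OF A_locD(3)[OF w0(1)] A_locD(3)[OF w1(1)] _ A_locD(4)[OF w0(1)]
            A_locD(4)[OF w1(1)] fin0 fin1 \<alpha>\<beta>]; simp add: w_eq)+
      have "AE x in lebesgue. 0 < w x"
        using A_locD(2)[OF w0(1)] A_locD(2)[OF w1(1)] by eventually_elim (simp add: w_eq)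
      then have pos: "0 < mass w (?Q j k)" for j and k :: "int ^ 'd"
        using emeasure_dyadic_cube_pos up(1) w_measurable by (intro mass_pos) auto
      obtain C where C: "0 < C" "\<And>j k. mass w0 (?Q j k) powr \<alpha> * mass w1 (?Q j k) powr \<beta> \<le> C * mass w (?Q j k)"
        unfolding w_eq by (rule A_loc_dyadic_interpolation[OF w0 w1 \<alpha>\<beta>]) blast
      \<comment> \<open>At least 1 for the upper bound, and at least \<open>C powr (1 / r)\<close>
        for the lower bound.\<close>
      define C' where "C' = max 1 (C powr (1 / r))"
      have root: "mass w0 (?Q j k) powr ((1 - \<Theta>) / r0) * mass w1 (?Q j k) powr (\<Theta> / r1)
        = (mass w0 (?Q j k) powr \<alpha> * mass w1 (?Q j k) powr \<beta>) powr (1 / r)" for j and k :: "int ^ 'd"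
        using r by (simp add: powr_mult powr_powr \<alpha>_def \<beta>_def)
      have "mass w (?Q j k) powr (1 / r) \<le> C' * (mass w0 (?Q j k) powr \<alpha> * mass w1 (?Q j k) powr \<beta>) powr (1 / r)"
        for j and k :: "int ^ 'd"
      proof -
        have "mass w (?Q j k) powr (1 / r) \<le> (mass w0 (?Q j k) powr \<alpha> * mass w1 (?Q j k) powr \<beta>) powr (1 / r)"
          using up(2) r by (intro powr_mono2) auto
        also have "\<dots> \<le> C' * \<dots>"
          using mult_right_mono[of 1 C' "(mass w0 (?Q j k) powr \<alpha> * mass w1 (?Q j k) powr \<beta>) powr (1 / r)"]
          by (simp add: C'_def)
        finally show ?thesis .
      qed
      moreover have "(mass w0 (?Q j k) powr \<alpha> * mass w1 (?Q j k) powr \<beta>) powr (1 / r) \<le> C' * mass w (?Q j k) powr (1 / r)"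
        for j and k :: "int ^ 'd"
      proof -
        have "(mass w0 (?Q j k) powr \<alpha> * mass w1 (?Q j k) powr \<beta>) powr (1 / r) \<le> (C * mass w (?Q j k)) powr (1 / r)"
          using C r by (intro powr_mono2) auto
        also have "\<dots> = C powr (1 / r) * mass w (?Q j k) powr (1 / r)"
          using C(1) by (simp add: powr_mult)
        also have "\<dots> \<le> C' * mass w (?Q j k) powr (1 / r)"
          by (intro mult_right_mono) (auto simp: C'_def)
        finally show ?thesis .
      qed
      moreover have "0 < C'"
        by (simp add: C'_def)
      ultimately show ?thesis
        unfolding root using w_measurable up(1) pos by blast
    qed
  qed
  then obtain C where w_measurable: "w \<in> borel_measurable lebesgue"
    and w_cube: "\<And>j k. integral_over (?Q j k) w < \<infinity>" "\<And>j k. 0 < mass w (?Q j k)" and C: "0 < C"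
    and le: "\<And>j k. mass w (?Q j k) powr (1 / r)
        \<le> C * (mass w0 (?Q j k) powr ((1 - \<Theta>) / r0) * mass w1 (?Q j k) powr (\<Theta> / r1))"
    and ge: "\<And>j k. mass w0 (?Q j k) powr ((1 - \<Theta>) / r0) * mass w1 (?Q j k) powr (\<Theta> / r1)
        \<le> C * mass w (?Q j k) powr (1 / r)"
    by blast
  \<comment> \<open>The powers of 2 combine because \<open>s\<close> is the average of
    \<open>s0\<close> and \<open>s1\<close>; the product weight then differs from the weight of the
    target space only in the masses.\<close>
  have split: "cube_weight s0 p0 w0 (j, k) powr (1 - \<Theta>) * cube_weight s1 p1 w1 (j, k) powr \<Theta>
    = 2 powr (s * real j) * (mass w0 (?Q j k) powr ((1 - \<Theta>) / r0) * mass w1 (?Q j k) powr (\<Theta> / r1))" for j and k :: "int ^ 'd"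
  proof -
    have "2 powr (s * real j) = 2 powr (s0 * real j * (1 - \<Theta>)) * 2 powr (s1 * real j * \<Theta>)"
      unfolding powr_add[symmetric] by (simp add: assms(9) algebra_simps)
    then show ?thesis
      by (simp add: cube_weight_def powr_mult powr_powr r0_def r1_def mult.commute)
  qed
  show ?thesis
    unfolding b_space_eq_mixed_space[OF assms(3) A_locD(3)[OF w0(1)] fin0 pos0]
      b_space_eq_mixed_space[OF assms(4) A_locD(3)[OF w1(1)] fin1 pos1]
      b_space_eq_mixed_space[OF rel(1) w_measurable w_cube]
  proof (rule calderon_product_mixed_space[OF assms(1-8) _ _ C])
    fix x :: "nat \<times> (int ^ 'd)"
    obtain j k where x: "x = (j, k)"
      by force
    show "0 < cube_weight s0 p0 w0 x" "0 < cube_weight s1 p1 w1 x"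
      using pos0[of j k] pos1[of j k] by (simp_all add: x cube_weight_def)
    have "cube_weight s p w x = 2 powr (s * real j) * mass w (?Q j k) powr (1 / r)"
      by (simp add: x cube_weight_def r_def)
    then show "cube_weight s p w x \<le> C * (cube_weight s0 p0 w0 x powr (1 - \<Theta>) * cube_weight s1 p1 w1 x powr \<Theta>)"
      "cube_weight s0 p0 w0 x powr (1 - \<Theta>) * cube_weight s1 p1 w1 x powr \<Theta> \<le> C * cube_weight s p w x"
      using mult_left_mono[OF le, of "2 powr (s * real j)" j k] mult_left_mono[OF ge, of "2 powr (s * real j)" j k]
      by (simp_all add: x split mult.left_commute[of C])
  qed
qed

end
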